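(* Let $n\ge2$ and let $\pi=1\ n\ n-1\ \cdots\ 2\in S_n$. The canonical triangulation of the vertex figure $\mathcal{V}(P_n)$ is a geometric realization of the pipe dream complex $PD(\pi)$. That is, as a simplicial complex it is isomorphic to $PD(\pi)$.
   Context: Root polytopes: let $e_1,\dots,e_n$ be the standard basis of $\mathbb{R}^n$ and $\Phi^+=\{e_i-e_j:1\le i<j\le n\}$. For a graph $G$ on $[n]$ (edges $(i,j)$ with $i<j$), let $\mathcal{C}(G)$ be the cone of nonnegative combinations of $\{e_i-e_j:(i,j)\in E(G)\}$, and define $\mathcal{P}(G)=\mathrm{ConvHull}(\{0\}\cup(\Phi^+\cap\mathcal{C}(G)))$. Let $P_n$ be the path with edges $(i,i+1)$, $i\in[n-1]$. The vertex figure $\mathcal{V}(P_n)$ is $\mathcal{P}(P_n)\cap\mathcal{H}$ for a hyperplane $\mathcal{H}$ separating $0$ strictly from all other vertices of $\mathcal{P}(P_n)$. A graph on $[n]$ is noncrossing if there are no $i<j<k<l$ with $(i,k)$ and $(j,l)$ both edges. It is alternating if there are no $i<j<k$ with $(i,j)$ and $(j,k)$ both edges. If $T_1,\dots,T_k$ are the noncrossing alternating spanning trees of $K_n$, the sets $\mathcal{P}(T_i)\cap\mathcal{V}(P_n)$ are the top-dimensional simplices of a triangulation of $\mathcal{V}(P_n)$, whose faces are the sets $\mathcal{P}(H)\cap\mathcal{V}(P_n)$ for subgraphs $H$ of these trees. This is the canonical triangulation of $\mathcal{V}(P_n)$. Pipe dream complex: let $s_k=(k\ k+1)$ and $l$ be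 the Coxeter length. Let $D_n=\{(i,j):i,j\ge1,\ i+j\le n\}$. Reading rows top to bottom, each right to left, and assigning $s_{i+j-1}$ to box $(i,j)$, gives the triangular word $Q=(s_{n-1},\dots,s_1,\ s_{n-1},\dots,s_2,\ \dots,\ s_{n-1})$. For $w\in S_n$, $PD(w)$ is the simplicial complex on vertex set $D_n$ whose faces are the sets $F\subseteq D_n$ such that the subword of $Q$ in positions $D_n\setminus F$ contains a reduced word for $w$. Its facets correspond to reduced pipe dreams, i.e., sets $P\subseteq D_n$ of crosses forming a reduced word for $w$, with facet $D_n\setminus P$. *)

theory Defs
  imports "HOL-Analysis.Analysis" "HOL-Combinatorics.Transposition" "HOL-Library.Sublist"
begin

section \<open>Graphs on \<open>{1..n}\<close>\<close>

text \<open>A graph on \<open>{1..n}\<close> is identified with its edge set, an edge being a pair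
  \<open>(i, j)\<close> with \<open>i < j\<close>, that is, with a subset of \<open>complete_graph n\<close>.\<close>

type_synonym edges = "(nat \<times> nat) set"

definition complete_graph :: "nat \<Rightarrow> edges" where
  "complete_graph n = {(i, j). 1 \<le> i \<and> i < j \<and> j \<le> n}"

definition path_graph :: "nat \<Rightarrow> edges" where
  "path_graph n = {(i, i + 1) | i. 1 \<le> i \<and> i \<le> n - 1}"

definition noncrossing :: "edges \<Rightarrow> bool" where
  "noncrossing G \<longleftrightarrow>
     \<not> (\<exists>i j k l. i < j \<and> j < k \<and> k < l \<and> (i, k) \<in> G \<and> (j, l) \<in> G)"

definition alternating :: "edges \<Rightarrow> bool" where
  "alternating G \<longleftrightarrow> \<not> (\<exists>i j k. i < j \<and> j < k \<and> (i, j) \<in> G \<and> (j, k) \<in> G)"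

definition adjacent :: "edges \<Rightarrow> nat \<Rightarrow> nat \<Rightarrow> bool" where
  "adjacent G u v \<longleftrightarrow> (u, v) \<in> G \<or> (v, u) \<in> G"

definition connected_graph :: "nat \<Rightarrow> edges \<Rightarrow> bool" where
  "connected_graph n G \<longleftrightarrow> (\<forall>u\<in>{1..n}. \<forall>v\<in>{1..n}. (adjacent G)\<^sup>*\<^sup>* u v)"

definition graph_cycle :: "edges \<Rightarrow> nat list \<Rightarrow> bool" where
  "graph_cycle G c \<longleftrightarrow>
     length c \<ge> 3 \<and> distinct c \<and> successively (adjacent G) (c @ [hd c])"

definition spanning_tree :: "nat \<Rightarrow> edges \<Rightarrow> bool" where
  "spanning_tree n T \<longleftrightarrow>
     T \<subseteq> complete_graph n \<and> connected_graph n T \<and> (\<nexists>c. graph_cycle T c)"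


section \<open>Root polytopes\<close>

text \<open>Throughout, \<open>e\<close> lists the standard basis vectors \<open>e 1, \<dots>, e n\<close>.\<close>

definition root :: "(nat \<Rightarrow> 'a::euclidean_space) \<Rightarrow> nat \<times> nat \<Rightarrow> 'a" where
  "root e = (\<lambda>(i, j). e i - e j)"

definition positive_roots :: "(nat \<Rightarrow> 'a::euclidean_space) \<Rightarrow> nat \<Rightarrow> 'a set" where
  "positive_roots e n = root e ` complete_graph n"

definition root_cone :: "(nat \<Rightarrow> 'a::euclidean_space) \<Rightarrow> edges \<Rightarrow> 'a set" where
  "root_cone e G = {(\<Sum>x\<in>G. c x *\<^sub>R root e x) | c. \<forall>x\<in>G. (0::real) \<le> c x}"

definition root_polytope :: "(nat \<Rightarrow> 'a::euclidean_space) \<Rightarrow> nat \<Rightarrow> edges \<Rightarrow> 'a set" where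
  "root_polytope e n G = convex hull ({0} \<union> (positive_roots e n \<inter> root_cone e G))"

definition separates_zero :: "'a::euclidean_space set \<Rightarrow> 'a set \<Rightarrow> bool" where
  "separates_zero H P \<longleftrightarrow>
     (\<exists>a b. a \<noteq> 0 \<and> H = {x. a \<bullet> x = b} \<and> a \<bullet> 0 < b \<and>
        (\<forall>v. v extreme_point_of P \<and> v \<noteq> 0 \<longrightarrow> b < a \<bullet> v))"

definition vertex_figure ::
    "(nat \<Rightarrow> 'a::euclidean_space) \<Rightarrow> nat \<Rightarrow> 'a set \<Rightarrow> 'a set" where
  "vertex_figure e n H = root_polytope e n (path_graph n) \<inter> H"

text \<open>All simplices are collected, the empty one (from the graph without edges) included.\<close>

definition canonical_triangulation ::
    "(nat \<Rightarrow> 'a::euclidean_space) \<Rightarrow> nat \<Rightarrow> 'a set \<Rightarrow> 'a set set" where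
  "canonical_triangulation e n H =
     {root_polytope e n G \<inter> vertex_figure e n H | G T.
        spanning_tree n T \<and> noncrossing T \<and> alternating T \<and> G \<subseteq> T}"


section \<open>Pipe dream complexes\<close>

text \<open>Elements of \<open>S\<^sub>n\<close> are functions on \<open>nat\<close> fixing everything outside \<open>{1..n}\<close>;
  a word in the simple transpositions is the list of their indices.\<close>

definition simple_transposition :: "nat \<Rightarrow> nat \<Rightarrow> nat" where
  "simple_transposition k = Transposition.transpose k (k + 1)"

definition word_product :: "nat list \<Rightarrow> nat \<Rightarrow> nat" where
  "word_product ks = foldr (\<lambda>k p. simple_transposition k \<circ> p) ks id"

definition word_for :: "nat \<Rightarrow> (nat \<Rightarrow> nat) \<Rightarrow> nat list \<Rightarrow> bool" where
  "word_for n w ks \<longleftrightarrow> set ks \<subseteq> {1..n - 1} \<and> word_product ks = w"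

definition coxeter_length :: "nat \<Rightarrow> (nat \<Rightarrow> nat) \<Rightarrow> nat" where
  "coxeter_length n w = (LEAST m. \<exists>ks. word_for n w ks \<and> length ks = m)"

definition reduced_word :: "nat \<Rightarrow> (nat \<Rightarrow> nat) \<Rightarrow> nat list \<Rightarrow> bool" where
  "reduced_word n w ks \<longleftrightarrow> word_for n w ks \<and> length ks = coxeter_length n w"

definition boxes :: "nat \<Rightarrow> (nat \<times> nat) set" where
  "boxes n = {(i, j). 1 \<le> i \<and> 1 \<le> j \<and> i + j \<le> n}"

text \<open>The boxes in reading order: rows from top to bottom, each from right to left.\<close>

definition reading_order :: "nat \<Rightarrow> (nat \<times> nat) list" where
  "reading_order n =
     concat (map (\<lambda>i. map (\<lambda>j. (i, j)) (rev [1..<Suc (n - i)])) [1..<n])"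

definition triangular_subword :: "nat \<Rightarrow> (nat \<times> nat) set \<Rightarrow> nat list" where
  "triangular_subword n S =
     map (\<lambda>(i, j). i + j - 1) (filter (\<lambda>p. p \<in> S) (reading_order n))"

definition pipe_dream_complex :: "nat \<Rightarrow> (nat \<Rightarrow> nat) \<Rightarrow> (nat \<times> nat) set set" where
  "pipe_dream_complex n w =
     {F. F \<subseteq> boxes n \<and>
         (\<exists>ks. subseq ks (triangular_subword n (boxes n - F)) \<and> reduced_word n w ks)}"

text \<open>The permutation with one-line notation \<open>1 n (n - 1) \<dots> 2\<close>.\<close>

definition pi_perm :: "nat \<Rightarrow> nat \<Rightarrow> nat" where
  "pi_perm n = (\<lambda>i. if 2 \<le> i \<and> i \<le> n then n + 2 - i else i)"


section \<open>Geometric realizations\<close>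

definition vertex_sets :: "'a::euclidean_space set set \<Rightarrow> 'a set set" where
  "vertex_sets K = (\<lambda>S. {v. v extreme_point_of S}) ` K"

text \<open>An isomorphism between the complexes \<open>\<Delta>\<close> and \<open>\<Delta>'\<close> (families of faces) on the vertex
  sets \<open>V\<close> and \<open>V'\<close>.\<close>

definition isomorphic_complexes ::
    "'a set \<Rightarrow> 'a set set \<Rightarrow> 'b set \<Rightarrow> 'b set set \<Rightarrow> bool" where
  "isomorphic_complexes V \<Delta> V' \<Delta>' \<longleftrightarrow>
     (\<exists>f. bij_betw f V V' \<and> (\<lambda>F. f ` F) ` \<Delta> = \<Delta>')"

definition geometric_realization ::
    "'a::euclidean_space set set \<Rightarrow> 'b set \<Rightarrow> 'b set set \<Rightarrow> bool" where
  "geometric_realization K V \<Delta> \<longleftrightarrow>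
     simplicial_complex K \<and>
     isomorphic_complexes V \<Delta> (\<Union> (vertex_sets K)) (vertex_sets K)"

end

theory Submission
  imports Defs
begin

text \<open>Box \<open>(i, j)\<close> corresponds to the edge \<open>(i, n + 1 - j)\<close>. A set of boxes then becomes a
  noncrossing alternating graph iff it contains no boxes \<open>(i, a)\<close>, \<open>(j, b)\<close> with \<open>i < j\<close>,
  \<open>b < a\<close> and \<open>j + a \<le> n + 1\<close>, and both complexes consist of the sets without such a conflict.

  For the pipe dream complex, fix a threshold \<open>t\<close> and watch the positions of the entries above
  \<open>t\<close> in the one-line notation while the word is read: the transposition \<open>s\<^sub>k\<close> only changes
  their number among the first \<open>k\<close> positions. A conflict with \<open>a = t\<close> delays one of them by a
  row and then blocks it; without a conflict, applying greedily all transpositions that create an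
  inversion sorts the entries into \<open>\<pi>\<close> for every threshold, and the applied ones form a
  reduced word.

  For the triangulation, a nonnegative combination of roots supported on a noncrossing alternating
  graph is determined by its value: the first sink has to be matched with the last source before
  it. Hence the roots of such graphs span simplicial cones meeting in common faces. Maximal
  noncrossing alternating graphs are spanning trees, so that all of these graphs occur.\<close>

section \<open>Words in the simple transpositions\<close>

text \<open>For a permutation these are corner sums of its permutation matrix, and they determine
  it. Fixing \<open>t\<close> reduces the one-line notation to marked and unmarked
  positions.\<close>

definition count_above :: "nat \<Rightarrow> (nat \<Rightarrow> nat) \<Rightarrow> nat \<Rightarrow> nat" where
  "count_above t f k = card {m \<in> {1..k}. t < f m}"

lemma count_above_0 [simp]: "count_above t f 0 = 0"
  by (simp add: count_above_def)

lemma count_above_Suc: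
  "count_above t f (Suc k) = count_above t f k + (if t < f (Suc k) then 1 else 0)"
proof -
  have "{m \<in> {1..Suc k}. t < f m} =
      (if t < f (Suc k) then insert (Suc k) {m \<in> {1..k}. t < f m} else {m \<in> {1..k}. t < f m})"
    by (auto simp: le_Suc_eq)
  then show ?thesis
    by (simp add: count_above_def)
qed

lemma count_above_Suc_le: "count_above t f (Suc k) \<le> count_above t f k + 1"
  by (simp add: count_above_Suc)

lemma count_above_mono: "k \<le> l \<Longrightarrow> count_above t f k \<le> count_above t f l"
  unfolding count_above_def by (rule card_mono) auto

lemma simple_transposition_mem:
  "k \<ge> 1 \<Longrightarrow> j \<noteq> k \<Longrightarrow> simple_transposition k m \<in> {1..j} \<longleftrightarrow> m \<in> {1..j}"
  by (simp add: simple_transposition_def Transposition.transpose_def) arith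

lemma simple_transposition_involutory [simp]:
  "simple_transposition k (simple_transposition k m) = m"
  by (simp add: simple_transposition_def)

lemma inj_simple_transposition: "inj (simple_transposition k)"
  by (rule inj_on_inverseI[of _ "simple_transposition k"]) simp

text \<open>The transposition maps the first \<open>j\<close> positions to themselves unless
  \<open>j = k\<close>, so it carries one counted set onto the other.\<close>

lemma count_above_swap_other:
  assumes "k \<ge> 1" "j \<noteq> k"
  shows "count_above t (f \<circ> simple_transposition k) j = count_above t f j"
proof -
  let ?s = "simple_transposition k"
  have "m \<in> {m \<in> {1..j}. t < (f \<circ> ?s) m} \<longleftrightarrow> ?s m \<in> {m \<in> {1..j}. t < f m}" for m
    using simple_transposition_mem[OF assms, of m] by (metis (no_types, lifting) comp_apply mem_Collect_eq)
  then have "{m \<in> {1..j}. t < (f \<circ> ?s) m} = ?s ` {m \<in> {1..j}. t < f m}"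
    using inj_image_mem_iff[OF inj_simple_transposition[of k], of "?s m" for m]
    by (intro set_eqI) simp
  then show ?thesis
    unfolding count_above_def
    by (simp only: card_image[OF inj_on_subset[OF inj_simple_transposition subset_UNIV]])
qed

lemma word_product_Nil [simp]: "word_product [] = id"
  and word_product_Cons [simp]:
    "word_product (k # ks) = simple_transposition k \<circ> word_product ks"
  by (simp_all add: word_product_def)

lemma word_product_append: "word_product (xs @ ys) = word_product xs \<circ> word_product ys"
  by (induction xs) (simp_all add: o_assoc)

lemma count_above_word_notin:
  "0 \<notin> set ks \<Longrightarrow> k \<notin> set ks \<Longrightarrow>
     count_above t (f \<circ> word_product ks) k = count_above t f k"
proof (induction ks arbitrary: f)
  case (Cons a ks)
  then have "count_above t ((f \<circ> simple_transposition a) \<circ> word_product ks) k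
      = count_above t (f \<circ> simple_transposition a) k"
    by (intro Cons.IH) auto
  also have "\<dots> = count_above t f k"
    using Cons.prems by (intro count_above_swap_other) auto
  finally show ?case
    by (simp only: word_product_Cons o_assoc)
qed auto

text \<open>Letters before \<open>Suc k\<close> are larger and leave the count at \<open>k\<close>
  alone; letters after it are smaller and leave the count at \<open>Suc k\<close> alone. This bounds
  how fast entries above \<open>t\<close> can move left within one row.\<close>

lemma count_above_decreasing_word:
  assumes "sorted_wrt (>) ks" "0 \<notin> set ks"
  shows "count_above t (f \<circ> word_product ks) (Suc k) \<le> count_above t f k + 1"
proof (cases "Suc k \<in> set ks")
  case False
  then show ?thesis
    using count_above_word_notin[OF assms(2) False, of t f] count_above_Suc_le[of t f k]
    by linarith
next
  case True
  then obtain us ws where ks: "ks = us @ Suc k # ws"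
    using split_list by metis
  have us: "\<forall>x\<in>set us. x > Suc k" and ws: "\<forall>x\<in>set ws. x < Suc k"
    using assms(1) by (auto simp: ks sorted_wrt_append)
  define g where "g = f \<circ> word_product (us @ [Suc k])"
  have "count_above t (g \<circ> word_product ws) (Suc k) = count_above t g (Suc k)"
    using ws assms(2) by (intro count_above_word_notin) (auto simp: ks)
  moreover have "count_above t g k = count_above t f k"
    unfolding g_def using us assms(2) by (intro count_above_word_notin) (auto simp: ks)
  moreover have "f \<circ> word_product ks = g \<circ> word_product ws"
    unfolding g_def ks word_product_append word_product_Cons word_product_Nil by (simp add: comp_assoc)
  ultimately show ?thesis
    using count_above_Suc_le[of t g k] by (simp only:)
qed

section \<open>Rows of the triangular word\<close>

definition row_word :: "nat \<Rightarrow> (nat \<times> nat) set \<Rightarrow> nat \<Rightarrow> nat list" where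
  "row_word n F i =
     map (\<lambda>(i, j). i + j - 1)
       (filter (\<lambda>p. p \<in> boxes n - F) (map (\<lambda>j. (i, j)) (rev [1..<Suc (n - i)])))"

definition rows_word :: "nat \<Rightarrow> (nat \<times> nat) set \<Rightarrow> nat \<Rightarrow> nat list" where
  "rows_word n F y = concat (map (row_word n F) [1..<Suc y])"

lemma triangular_subword_eq_rows_word:
  "triangular_subword n (boxes n - F) = rows_word n F (n - 1)"
proof -
  have eq: "map h (filter P (concat xss)) = concat (map (\<lambda>xs. map h (filter P xs)) xss)"
    for h :: "'x \<Rightarrow> 'y" and P xss
    by (induction xss) auto
  have "[1..<n] = [1..<Suc (n - 1)]"
    by (cases n) auto
  then show ?thesis
    unfolding triangular_subword_def rows_word_def reading_order_def eq
    by (simp add: row_word_def[abs_def] o_def del: upt_Suc)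
qed

lemma rows_word_0 [simp]: "rows_word n F 0 = []"
  by (simp add: rows_word_def)

lemma rows_word_Suc: "rows_word n F (Suc y) = rows_word n F y @ row_word n F (Suc y)"
  by (simp add: rows_word_def)

text \<open>In row \<open>i\<close> the letter \<open>k\<close> can only come from the box
  \<open>(i, k + 1 - i)\<close>.\<close>

lemma set_row_word:
  assumes "i \<ge> 1"
  shows "set (row_word n F i) = {k. i \<le> k \<and> k < n \<and> (i, k + 1 - i) \<notin> F}"
proof -
  have "k \<in> set (row_word n F i) \<longleftrightarrow> i \<le> k \<and> k < n \<and> (i, k + 1 - i) \<notin> F" for k
  proof
    assume "k \<in> set (row_word n F i)"
    then obtain j where "k = i + j - 1" "(i, j) \<in> boxes n - F"
      unfolding row_word_def set_map set_filter by auto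
    moreover from this have "k + 1 - i = j"
      using assms by (simp add: boxes_def)
    ultimately show "i \<le> k \<and> k < n \<and> (i, k + 1 - i) \<notin> F"
      using assms by (auto simp: boxes_def)
  next
    assume k: "i \<le> k \<and> k < n \<and> (i, k + 1 - i) \<notin> F"
    then have "(i, k + 1 - i) \<in> boxes n - F" "k + 1 - i \<in> set (rev [1..<Suc (n - i)])"
      using assms by (auto simp: boxes_def simp del: upt_Suc)
    moreover have "i + (k + 1 - i) - 1 = k"
      using k by simp
    ultimately show "k \<in> set (row_word n F i)"
      unfolding row_word_def set_map set_filter
      by (intro image_eqI[of _ _ "(i, k + 1 - i)"]) auto
  qed
  then show ?thesis by blast
qed

lemma set_rows_word: "set (rows_word n F y) \<subseteq> {1..n - 1}"
proof (induction y)
  case (Suc y)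
  have "set (row_word n F (Suc y)) \<subseteq> {1..n - 1}"
    unfolding set_row_word[of "Suc y", simplified] by auto
  with Suc show ?case
    by (simp add: rows_word_Suc)
qed simp

lemma sorted_row_word: "i \<ge> 1 \<Longrightarrow> sorted_wrt (>) (row_word n F i)"
proof -
  assume "i \<ge> 1"
  have "sorted_wrt (\<lambda>x y. x > y) (rev [1..<Suc (n - i)])"
    unfolding sorted_wrt_rev by (rule sorted_wrt_upt)
  then have "sorted_wrt (\<lambda>x y. i + x - 1 > i + y - 1) (rev [1..<Suc (n - i)])"
    by (rule sorted_wrt_mono_rel[rotated]) (use \<open>i \<ge> 1\<close> in auto)
  then have "sorted_wrt (\<lambda>x y. i + x - 1 > i + y - 1)
      (filter (\<lambda>j. (i, j) \<in> boxes n - F) (rev [1..<Suc (n - i)]))"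
    by (rule sorted_wrt_filter)
  then show ?thesis
    unfolding row_word_def filter_map sorted_wrt_map by (simp add: o_def del: upt_Suc)
qed

lemma sorted_wrt_subseq: "subseq xs ys \<Longrightarrow> sorted_wrt P ys \<Longrightarrow> sorted_wrt P xs"
proof (induction rule: list_emb.induct)
  case (list_emb_Cons2 x y xs ys)
  have "set xs \<subseteq> set ys"
    using list_emb_set[OF list_emb_Cons2.hyps(2)] by (metis subsetI)
  then show ?case
    using list_emb_Cons2 by auto
qed auto

section \<open>Conflicting boxes exclude words for \<open>pi_perm n\<close>\<close>

definition box_conflict :: "nat \<Rightarrow> (nat \<times> nat) set \<Rightarrow> bool" where
  "box_conflict n F \<longleftrightarrow>
     (\<exists>i a j b. (i, a) \<in> F \<and> (j, b) \<in> F \<and> i < j \<and> b < a \<and> j + a \<le> n + 1)"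

lemma box_conflictE:
  assumes "box_conflict n F"
  obtains i a j b where "(i, a) \<in> F" "(j, b) \<in> F" "i < j" "b < a" "j + a \<le> n + 1"
  using assms unfolding box_conflict_def by blast

text \<open>The entries above \<open>t\<close> stand in the positions \<open>2\<close> to
  \<open>n + 1 - t\<close>.\<close>

lemma count_above_pi_perm:
  assumes "1 \<le> k" "k \<le> n" "1 \<le> t"
  shows "count_above t (pi_perm n) k = min (k - 1) (n - t)"
  using assms(1,2)
proof (induction k rule: nat_induct_at_least)
  case base
  then show ?case
    using assms(3) count_above_Suc[of t "pi_perm n" 0] by (simp add: pi_perm_def)
next
  case (Suc k)
  have "count_above t (pi_perm n) (Suc k) = min (k - 1) (n - t) + (if t + k < n + 1 then 1 else 0)"
    using Suc by (simp add: count_above_Suc pi_perm_def less_diff_conv)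
  then show ?case
    using Suc by (auto simp: min_def)
qed

lemma rows_word_add:
  "rows_word n F (x + y)
     = rows_word n F x @ concat (map (row_word n F) [Suc x..<Suc (x + y)])"
  unfolding rows_word_def using upt_add_eq_append[of 1 "Suc x" y] by simp

lemma subseq_set_subset: "subseq xs ys \<Longrightarrow> set xs \<subseteq> set ys"
  by (rule subsetI) (auto elim: list_emb_set)

text \<open>A subword of a row still decreases. A box of \<open>F\<close> in the row removes its
  letter, so the count at that letter is frozen during the row, as it is at every \<open>k\<close>
  below \<open>i\<close>.\<close>

lemma row_word_subseq_count:
  assumes "subseq vs (row_word n F i)" "i \<ge> 1"
  shows "count_above t (f \<circ> word_product vs) (Suc k) \<le> count_above t f k + 1"
    and "(i, k + 1 - i) \<in> F \<or> k < i \<Longrightarrow> count_above t (f \<circ> word_product vs) k = count_above t f k"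
proof -
  have vs: "set vs \<subseteq> {k. i \<le> k \<and> k < n \<and> (i, k + 1 - i) \<notin> F}"
    using subseq_set_subset[OF assms(1)] set_row_word[OF assms(2)] by blast
  then have 0: "0 \<notin> set vs"
    using assms(2) by auto
  show "count_above t (f \<circ> word_product vs) (Suc k) \<le> count_above t f k + 1"
    using sorted_wrt_subseq[OF assms(1) sorted_row_word[OF assms(2)]] 0
    by (rule count_above_decreasing_word)
  show "count_above t (f \<circ> word_product vs) k = count_above t f k"
    if "(i, k + 1 - i) \<in> F \<or> k < i"
    by (rule count_above_word_notin[OF 0]) (use vs that in auto)
qed

text \<open>Initially no entry above \<open>a\<close> is among the first \<open>a\<close> positions,
  and each row admits one more position and at most one more entry. Row \<open>i\<close> lacks the
  box \<open>(i, a)\<close>, whose letter is \<open>a + i - 1\<close>, so it admits neither; from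
  then on both bounds are one lower.\<close>

lemma conflict_delays_rows:
  assumes "(i, a) \<in> F" "1 \<le> i" "1 \<le> a" "subseq ks (rows_word n F y)"
  shows "count_above a (word_product ks) (if y < i then a + y else a + y - 1)
     \<le> (if y < i then y else y - 1)"
  using assms(4)
proof (induction y arbitrary: ks)
  case 0
  then have "subseq ks []"
    by simp
  then have "ks = []"
    by (rule list_emb_Nil2)
  then show ?case
    using assms by (simp add: count_above_def)
next
  case (Suc y)
  from Suc.prems obtain us vs where ks: "ks = us @ vs" and us: "subseq us (rows_word n F y)"
    and vs: "subseq vs (row_word n F (Suc y))"
    unfolding rows_word_Suc by (rule subseq_appendE)
  note IH = Suc.IH[OF us]
  have wp: "word_product ks = word_product us \<circ> word_product vs"
    by (simp only: ks word_product_append)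
  note row = row_word_subseq_count(1)[OF vs, of a "word_product us", folded wp]
  consider "Suc y < i" | "Suc y = i" | "i < Suc y" by linarith
  then show ?case
  proof cases
    case 1
    then show ?thesis
      using IH row[of "a + y"] by simp
  next
    case 2
    have "(a + y) + 1 - Suc y = a"
      by simp
    with 2 assms(1) have "(Suc y, (a + y) + 1 - Suc y) \<in> F"
      by metis
    then have "count_above a (word_product ks) (a + y) = count_above a (word_product us) (a + y)"
      unfolding wp by (intro row_word_subseq_count(2)[OF vs]) simp_all
    then show ?thesis
      using IH by (simp flip: 2)
  next
    case 3
    then have "Suc (a + y - 1) = a + y" "y - 1 + 1 = y"
      using assms(2,3) by simp_all
    then show ?thesis
      using IH 3 row[of "a + y - 1"] by simp
  qed
qed

text \<open>Row \<open>j\<close> freezes the count at position \<open>j + b - 1\<close>, which is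
  not beyond \<open>a + j - 2\<close> because \<open>b < a\<close>; so after row \<open>j\<close> at
  most \<open>j - 2\<close> entries above \<open>a\<close> are among the first \<open>j\<close>
  positions. Later rows have only letters above \<open>j\<close> and cannot repair this, while
  \<open>pi_perm n\<close> needs \<open>j - 1\<close> such entries.\<close>

lemma pi_word_avoids_conflict:
  assumes "F \<subseteq> boxes n" "subseq ks (triangular_subword n (boxes n - F))"
    and "word_product ks = pi_perm n"
  shows "\<not> box_conflict n F"
proof
  assume "box_conflict n F"
  then obtain i a j b where F: "(i, a) \<in> F" "(j, b) \<in> F"
    and lt: "i < j" "b < a" "j + a \<le> n + 1"
    unfolding box_conflict_def by blast
  have box: "1 \<le> i" "1 \<le> b" "j + b \<le> n"
    using F assms(1) by (auto simp: boxes_def)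
  obtain j' where j': "j = Suc j'"
    using lt by (cases j) auto
  have "n - 1 = j + (n - 1 - j)"
    using box by simp
  then have "rows_word n F (n - 1)
      = rows_word n F j @ concat (map (row_word n F) [Suc j..<Suc (n - 1)])"
    using rows_word_add[of n F j "n - 1 - j"] by metis
  moreover have "Suc (n - 1) = n"
    using box by simp
  ultimately have split: "triangular_subword n (boxes n - F)
      = rows_word n F j' @ row_word n F j @ concat (map (row_word n F) [Suc j..<n])"
    unfolding triangular_subword_eq_rows_word by (simp only: j' rows_word_Suc append_assoc)
  obtain us vs ws where ks: "ks = us @ vs @ ws" and us: "subseq us (rows_word n F j')"
    and vs: "subseq vs (row_word n F j)" and ws: "subseq ws (concat (map (row_word n F) [Suc j..<n]))"
    using assms(2) unfolding split by (metis subseq_appendE)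
  have ws_set: "k > j" if "k \<in> set ws" for k
    using subseq_set_subset[OF ws] that set_row_word[of _ n F] by fastforce
  have "count_above a (word_product ks) j = count_above a (word_product us \<circ> word_product vs) j"
    unfolding ks word_product_append o_assoc
    using ws_set by (intro count_above_word_notin) fastforce+
  also have "\<dots> \<le> count_above a (word_product us \<circ> word_product vs) (j + b - 1)"
    using box by (intro count_above_mono) simp
  also have "\<dots> = count_above a (word_product us) (j + b - 1)"
    using F(2) box lt by (intro row_word_subseq_count(2)[OF vs]) simp_all
  also have "\<dots> \<le> count_above a (word_product us) (a + j' - 1)"
    using lt j' by (intro count_above_mono) simp
  also have "\<dots> \<le> j' - 1"
    using conflict_delays_rows[OF F(1) box(1) _ us] lt j' by (auto split: if_splits)
  also have "\<dots> < j - 1"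
    using lt box j' by simp
  \<comment> \<open>The minimum is \<open>j - 1\<close> because
    \<open>j + a \<le> n + 1\<close>.\<close>
  also have "j - 1 = count_above a (pi_perm n) j"
    using lt box by (subst count_above_pi_perm) auto
  finally show False
    using assms(3) by simp
qed

section \<open>Greedy sorting\<close>

definition inversions :: "nat \<Rightarrow> (nat \<Rightarrow> nat) \<Rightarrow> (nat \<times> nat) set" where
  "inversions n f = {(a, b). 1 \<le> a \<and> a < b \<and> b \<le> n \<and> f b < f a}"

lemma finite_inversions [simp]: "finite (inversions n f)"
  by (rule finite_subset[of _ "{1..n} \<times> {1..n}"]) (auto simp: inversions_def)

lemma word_product_snoc: "word_product (ks @ [k]) = word_product ks \<circ> simple_transposition k"
  by (simp only: word_product_append word_product_Cons word_product_Nil comp_id)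

lemma inversions_id [simp]: "inversions n (\<lambda>a. a) = {}" "inversions n id = {}"
  by (auto simp: inversions_def)

lemma simple_transposition_less:
  assumes "a < b" "(a, b) \<noteq> (k, Suc k)"
  shows "simple_transposition k a < simple_transposition k b"
  using assms by (simp add: simple_transposition_def Transposition.transpose_def) arith

lemma simple_transposition_bounds:
  assumes "1 \<le> k" "k < n"
  shows "simple_transposition k m \<in> {1..n} \<longleftrightarrow> m \<in> {1..n}"
  using assms by (intro simple_transposition_mem) auto

text \<open>Applying the transposition to both coordinates preserves the order of every pair of
  positions except \<open>(k, Suc k)\<close>, hence matches the remaining inversions of the two
  maps.\<close>

lemma card_inversions_swap_diff:
  assumes "1 \<le> k" "k < n"
  shows "card (inversions n (f \<circ> simple_transposition k) - {(k, Suc k)})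
       = card (inversions n f - {(k, Suc k)})"
proof -
  let ?s = "simple_transposition k"
  let ?S = "map_prod ?s ?s"
  have s: "?s k = Suc k" "?s (Suc k) = k"
    by (simp_all add: simple_transposition_def)
  have map: "?S p \<in> inversions n g - {(k, Suc k)}"
    if p: "p \<in> inversions n (g \<circ> ?s) - {(k, Suc k)}" for p g
  proof -
    obtain a b where ab: "p = (a, b)" "1 \<le> a" "a < b" "b \<le> n" "g (?s b) < g (?s a)"
      "(a, b) \<noteq> (k, Suc k)"
      using p by (auto simp: inversions_def)
    have "?s a < ?s b"
      using ab by (intro simple_transposition_less) auto
    moreover have "(?s a, ?s b) \<noteq> (k, Suc k)"
    proof
      assume "(?s a, ?s b) = (k, Suc k)"
      then have "a = ?s k" "b = ?s (Suc k)"
        by (metis prod.inject simple_transposition_involutory)+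
      then show False
        using ab s by simp
    qed
    moreover have "?s a \<in> {1..n}" "?s b \<in> {1..n}"
      using ab simple_transposition_bounds[OF assms] by simp_all
    ultimately show ?thesis
      using ab by (simp add: inversions_def)
  qed
  have inv: "?S (?S p) = p" for p
    by (cases p) simp
  have ss: "(f \<circ> ?s) \<circ> ?s = f"
    by (rule ext) simp
  have "bij_betw ?S (inversions n (f \<circ> ?s) - {(k, Suc k)}) (inversions n f - {(k, Suc k)})"
  proof (rule bij_betw_byWitness[of _ ?S])
    show "?S ` (inversions n f - {(k, Suc k)}) \<subseteq> inversions n (f \<circ> ?s) - {(k, Suc k)}"
      by (intro image_subsetI map) (simp only: ss)
    show "?S ` (inversions n (f \<circ> ?s) - {(k, Suc k)}) \<subseteq> inversions n f - {(k, Suc k)}"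
      by (intro image_subsetI map)
  qed (use inv in blast)+
  then show ?thesis
    by (rule bij_betw_same_card)
qed

lemma card_inversions_swap_le:
  assumes "1 \<le> k" "k < n"
  shows "card (inversions n (f \<circ> simple_transposition k)) \<le> Suc (card (inversions n f))"
proof -
  have "card (inversions n (f \<circ> simple_transposition k))
      \<le> Suc (card (inversions n (f \<circ> simple_transposition k) - {(k, Suc k)}))"
    by (cases "(k, Suc k) \<in> inversions n (f \<circ> simple_transposition k)") (simp_all add: card_Suc_Diff1 del: card_Diff_insert)
  also have "\<dots> \<le> Suc (card (inversions n f))"
    unfolding card_inversions_swap_diff[OF assms] by (simp add: card_mono)
  finally show ?thesis .
qed

lemma card_inversions_ascent:
  assumes "1 \<le> k" "k < n" "f k < f (Suc k)"
  shows "card (inversions n (f \<circ> simple_transposition k)) = Suc (card (inversions n f))"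
proof -
  have "(k, Suc k) \<in> inversions n (f \<circ> simple_transposition k)" "(k, Suc k) \<notin> inversions n f"
    using assms by (auto simp: inversions_def simple_transposition_def)
  then show ?thesis
    using card_inversions_swap_diff[OF assms(1,2), of f]
      card_Suc_Diff1[of "inversions n (f \<circ> simple_transposition k)" "(k, Suc k)"]
    by simp
qed

text \<open>Each letter adds at most one inversion. Thus a word with exactly as many letters as its
  product has inversions is reduced.\<close>

lemma card_inversions_word_le:
  "set ks \<subseteq> {1..n - 1} \<Longrightarrow> card (inversions n (word_product ks)) \<le> length ks"
proof (induction ks rule: rev_induct)
  case Nil
  show ?case
    by simp
next
  case (snoc k ks)
  then have "card (inversions n (word_product ks \<circ> simple_transposition k))
      \<le> Suc (card (inversions n (word_product ks)))"
    by (intro card_inversions_swap_le) auto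
  moreover have "card (inversions n (word_product ks)) \<le> length ks"
    using snoc by simp
  ultimately show ?case
    unfolding word_product_snoc length_append_singleton by linarith
qed

text \<open>One step of the Demazure product: a letter that would not create an inversion at its two
  positions is skipped. \<open>foldl bubble id W\<close> is the Demazure product of the word
  \<open>W\<close>.\<close>

definition bubble :: "(nat \<Rightarrow> nat) \<Rightarrow> nat \<Rightarrow> nat \<Rightarrow> nat" where
  "bubble f k = (if f k < f (Suc k) then f \<circ> simple_transposition k else f)"

text \<open>Every letter that is applied adds exactly one inversion, so the applied letters form a
  subword of the length that reducedness requires.\<close>

lemma bubble_reduced_subword:
  assumes "set W \<subseteq> {1..n - 1}"
  shows "\<exists>ks. subseq ks W \<and> foldl bubble id W = word_product ks
     \<and> card (inversions n (foldl bubble id W)) = length ks"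
  using assms
proof (induction W rule: rev_induct)
  case Nil
  show ?case
    by (intro exI[of _ "[]"] conjI) simp_all
next
  case (snoc k W)
  have "set W \<subseteq> {1..n - 1}"
    using snoc.prems by simp
  from snoc.IH[OF this] obtain ks where ks: "subseq ks W" "foldl bubble id W = word_product ks"
    "card (inversions n (foldl bubble id W)) = length ks"
    by blast
  let ?f = "foldl bubble id W"
  show ?case
  proof (cases "?f k < ?f (Suc k)")
    case True
    have "card (inversions n (?f \<circ> simple_transposition k)) = Suc (length ks)"
      using snoc.prems ks(3) by (subst card_inversions_ascent[OF _ _ True]) auto
    moreover have "foldl bubble id (W @ [k]) = ?f \<circ> simple_transposition k"
      using True by (simp only: foldl_append foldl.simps bubble_def[of ?f] if_True)
    moreover have "subseq (ks @ [k]) (W @ [k])"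
      using ks(1) by simp
    ultimately show ?thesis
      using ks(2) by (intro exI[of _ "ks @ [k]"]) (simp only: word_product_snoc length_append_singleton simp_thms)
  next
    case False
    then have "foldl bubble id (W @ [k]) = ?f"
      by (simp only: foldl_append foldl.simps bubble_def[of ?f] if_False)
    moreover have "subseq ks (W @ [k])"
      using ks(1) by (rule subseq_rev_drop_many)
    ultimately show ?thesis
      using ks(2,3) by (intro exI[of _ ks]) (simp only: simp_thms)
  qed
qed

lemma reduced_wordI:
  assumes "word_for n w ks" "card (inversions n w) = length ks"
  shows "reduced_word n w ks"
proof -
  have "(LEAST m. \<exists>ks. word_for n w ks \<and> length ks = m) = length ks"
  proof (rule Least_equality)
    fix m assume "\<exists>ks. word_for n w ks \<and> length ks = m"
    then obtain ks' where "set ks' \<subseteq> {1..n - 1}" "word_product ks' = w" "length ks' = m"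
      unfolding word_for_def by blast
    then show "length ks \<le> m"
      using card_inversions_word_le[of ks' n] assms(2) by simp
  qed (use assms(1) in blast)
  then show ?thesis
    using assms(1) by (simp add: reduced_word_def coxeter_length_def)
qed

section \<open>Greedy steps and prefix counts\<close>

lemma count_above_bubble_other:
  "k \<ge> 1 \<Longrightarrow> j \<noteq> k \<Longrightarrow> count_above t (bubble f k) j = count_above t f j"
  by (simp add: bubble_def count_above_swap_other del: comp_apply)

text \<open>The greedy step leaves the larger of the two entries at position \<open>k\<close>, so
  that position is above \<open>t\<close> as soon as one of \<open>k\<close> and
  \<open>Suc k\<close> was.\<close>

lemma count_above_bubble:
  assumes "k \<ge> 1"
  shows "min (count_above t f (k - 1) + 1) (count_above t f (Suc k)) \<le> count_above t (bubble f k) k"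
    and "count_above t f k \<le> count_above t (bubble f k) k"
proof -
  obtain l where l: "k = Suc l"
    using assms by (cases k) auto
  have "count_above t (bubble f k) k = count_above t f l + (if t < bubble f k k then 1 else 0)"
    using count_above_bubble_other[OF assms, of l t f] count_above_Suc[of t "bubble f k" l] l by simp
  moreover have "bubble f k k = max (f k) (f (Suc k))"
    by (simp add: bubble_def simple_transposition_def)
  ultimately show "min (count_above t f (k - 1) + 1) (count_above t f (Suc k)) \<le> count_above t (bubble f k) k"
    and "count_above t f k \<le> count_above t (bubble f k) k"
    by (auto simp: l count_above_Suc)
qed

lemma count_above_bubbles_mono:
  "0 \<notin> set W \<Longrightarrow> count_above t f k \<le> count_above t (foldl bubble f W) k"
proof (induction W rule: rev_induct)
  case (snoc a W)
  have "count_above t (foldl bubble f W) k \<le> count_above t (bubble (foldl bubble f W) a) k"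
    using count_above_bubble(2)[of a] count_above_bubble_other[of a k] snoc.prems
    by (cases "k = a") auto
  with snoc show ?case
    by simp
qed simp

lemma count_above_bubbles_notin:
  "0 \<notin> set W \<Longrightarrow> k \<notin> set W \<Longrightarrow> count_above t (foldl bubble f W) k = count_above t f k"
  by (induction W rule: rev_induct) (auto simp: count_above_bubble_other)

text \<open>The lower counterpart of \<open>count_above_decreasing_word\<close>. The letters before
  \<open>k\<close> cannot lower the count at \<open>k - 1\<close>, and the smaller letters after it
  leave the counts at \<open>k\<close> and \<open>Suc k\<close> alone, so only the single step at
  \<open>k\<close> matters.\<close>

lemma count_above_bubbles_decreasing:
  assumes "sorted_wrt (>) W" "0 \<notin> set W" "k \<in> set W"
  shows "min (count_above t f (k - 1) + 1) (count_above t (foldl bubble f W) (Suc k))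
     \<le> count_above t (foldl bubble f W) k"
proof -
  obtain us ws where W: "W = us @ k # ws"
    using split_list[OF assms(3)] by metis
  have us: "\<forall>x\<in>set us. x > k" and ws: "\<forall>x\<in>set ws. x < k" and nz: "0 \<notin> set us" "0 \<notin> set ws" "k \<ge> 1"
    using assms(1,2) by (auto simp: W sorted_wrt_append)
  define g where "g = foldl bubble f us"
  have fW: "foldl bubble f W = foldl bubble (bubble g k) ws"
    by (simp add: W g_def)
  have "count_above t f (k - 1) \<le> count_above t g (k - 1)"
    unfolding g_def using nz by (intro count_above_bubbles_mono) auto
  moreover have "count_above t (foldl bubble f W) (Suc k) = count_above t (bubble g k) (Suc k)"
    unfolding fW using ws nz by (intro count_above_bubbles_notin) auto
  moreover have "count_above t (bubble g k) (Suc k) = count_above t g (Suc k)"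
    using nz by (intro count_above_bubble_other) auto
  moreover have "count_above t (foldl bubble f W) k = count_above t (bubble g k) k"
    unfolding fW using ws nz by (intro count_above_bubbles_notin) auto
  moreover have "min (count_above t g (k - 1) + 1) (count_above t g (Suc k)) \<le> count_above t (bubble g k) k"
    using nz by (intro count_above_bubble)
  ultimately show ?thesis
    by linarith
qed

section \<open>Sorting row by row\<close>

definition sorted_rows :: "nat \<Rightarrow> (nat \<times> nat) set \<Rightarrow> nat \<Rightarrow> nat \<Rightarrow> nat" where
  "sorted_rows n F y = foldl bubble id (rows_word n F y)"

lemma zero_notin_rows: "0 \<notin> set (rows_word n F y)"
  using set_rows_word[of n F y] by auto

lemma sorted_rows_0: "sorted_rows n F 0 = id"
  by (simp only: sorted_rows_def rows_word_0 foldl.simps)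

lemma sorted_rows_Suc:
  "sorted_rows n F (Suc y) = foldl bubble (sorted_rows n F y) (row_word n F (Suc y))"
  by (simp only: sorted_rows_def rows_word_Suc foldl_append)

lemma count_above_sorted_rows_mono:
  assumes "x \<le> y"
  shows "count_above t (sorted_rows n F x) k \<le> count_above t (sorted_rows n F y) k"
  using assms
proof (induction rule: dec_induct)
  case (step y)
  have "0 \<notin> set (row_word n F (Suc y))"
    unfolding set_row_word[of "Suc y", simplified] by auto
  then have "count_above t (sorted_rows n F y) k \<le> count_above t (sorted_rows n F (Suc y)) k"
    unfolding sorted_rows_Suc by (rule count_above_bubbles_mono)
  with step.IH show ?case
    by linarith
qed simp

lemma count_above_id: "count_above t id k = k - t"
  by (induction k) (auto simp: count_above_Suc)

lemma count_above_sorted_rows_ge: "k - t \<le> count_above t (sorted_rows n F y) k"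
  using count_above_sorted_rows_mono[of 0 y t n F k] unfolding sorted_rows_0 count_above_id
  by simp

lemma count_above_sorted_rows_n:
  assumes "n \<ge> 1"
  shows "count_above t (sorted_rows n F y) n = n - t"
proof -
  have "n \<notin> set (rows_word n F y)"
    using set_rows_word[of n F y] assms by fastforce
  then show ?thesis
    unfolding sorted_rows_def using count_above_bubbles_notin[OF zero_notin_rows] count_above_id by metis
qed

lemma count_above_sorted_rows_step:
  assumes "y < k" "k < n" "(Suc y, k - y) \<notin> F"
  shows "min (count_above t (sorted_rows n F y) (k - 1) + 1)
       (count_above t (sorted_rows n F (Suc y)) (Suc k))
     \<le> count_above t (sorted_rows n F (Suc y)) k"
  unfolding sorted_rows_Suc
proof (rule count_above_bubbles_decreasing)
  show "sorted_wrt (>) (row_word n F (Suc y))"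
    by (rule sorted_row_word) simp
  show "0 \<notin> set (row_word n F (Suc y))" "k \<in> set (row_word n F (Suc y))"
    unfolding set_row_word[of "Suc y", simplified] using assms by auto
qed

text \<open>With the threshold \<open>t\<close> fixed, the entries above \<open>t\<close> move to the left one after the
  other: after row \<open>y\<close> the first \<open>y - 1\<close> of them have arrived at \<open>2, \<dots>, y\<close>, and the \<open>y\<close>-th one
  is held back exactly by the boxes of \<open>F\<close> in the first \<open>y\<close> rows and \<open>t\<close> columns.\<close>

definition rows_progress :: "nat \<Rightarrow> (nat \<times> nat) set \<Rightarrow> nat \<Rightarrow> nat \<Rightarrow> bool" where
  "rows_progress n F t y \<longleftrightarrow>
     (\<forall>k\<le>n. min (k - 1) (y - 1) \<le> count_above t (sorted_rows n F y) k) \<and>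
     (\<forall>k\<le>n. y < k \<longrightarrow> (\<forall>(i, c)\<in>F. i \<le> y \<and> c \<le> t \<longrightarrow> c \<le> k - y) \<longrightarrow>
        y \<le> count_above t (sorted_rows n F y) k)"

text \<open>This carries the first half of \<open>rows_progress\<close> over to row
  \<open>Suc y\<close>. For \<open>k\<close> beyond \<open>y\<close> the induction descends from
  \<open>n\<close>, where all \<open>n - t\<close> entries above \<open>t\<close> are
  counted.\<close>

lemma rows_progress_arrived:
  assumes "rows_progress n F t y" "\<not> box_conflict n F" "y + t \<le> n" "Suc y < n" "k \<le> n"
  shows "min (k - 1) y \<le> count_above t (sorted_rows n F (Suc y)) k"
proof (cases "k \<le> y")
  case True
  then have "min (k - 1) y = min (k - 1) (y - 1)"
    by simp
  also have "\<dots> \<le> count_above t (sorted_rows n F y) k"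
    using assms(1,5) by (simp add: rows_progress_def)
  also have "\<dots> \<le> count_above t (sorted_rows n F (Suc y)) k"
    by (rule count_above_sorted_rows_mono) simp
  finally show ?thesis .
next
  case False
  have "y < k \<longrightarrow> y \<le> count_above t (sorted_rows n F (Suc y)) k"
    using assms(5)
  proof (induction k rule: inc_induct)
    case base
    have "count_above t (sorted_rows n F (Suc y)) n = n - t"
      using assms(4) by (intro count_above_sorted_rows_n) simp
    then show ?case
      using assms(3) by linarith
  next
    case (step k)
    show ?case
    proof
      assume yk: "y < k"
      show "y \<le> count_above t (sorted_rows n F (Suc y)) k"
      proof (cases "\<forall>(i, c)\<in>F. i \<le> y \<and> c \<le> t \<longrightarrow> c \<le> k - y")
        case True
        then have "y \<le> count_above t (sorted_rows n F y) k"
          using assms(1) step.hyps yk unfolding rows_progress_def by simp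
        also have "\<dots> \<le> count_above t (sorted_rows n F (Suc y)) k"
          by (rule count_above_sorted_rows_mono) simp
        finally show ?thesis .
      next
        case False
        then obtain i c where "(i, c) \<in> F" "i \<le> y" "c \<le> t" "\<not> c \<le> k - y"
          by blast
        \<comment> \<open>The box \<open>(i, c)\<close> may hold the \<open>y\<close>-th entry back.
          Together with \<open>(Suc y, k - y)\<close>, which lies below it and further left, it
          would be a conflict, since \<open>Suc y + c \<le> n + 1\<close>. So the row contains the
          letter \<open>k\<close>.\<close>
        then have "(Suc y, k - y) \<notin> F"
          using assms(2,3) unfolding box_conflict_def by fastforce
        then have "min (count_above t (sorted_rows n F y) (k - 1) + 1)
            (count_above t (sorted_rows n F (Suc y)) (Suc k))
            \<le> count_above t (sorted_rows n F (Suc y)) k"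
          using yk step.hyps by (intro count_above_sorted_rows_step) simp_all
        moreover have "k - 1 \<le> n"
          using step.hyps by simp
        then have "min (k - 1 - 1) (y - 1) \<le> count_above t (sorted_rows n F y) (k - 1)"
          using assms(1) unfolding rows_progress_def by blast
        ultimately show ?thesis
          using step.IH yk by linarith
      qed
    qed
  qed
  with False show ?thesis
    by simp
qed

text \<open>The first half is the preceding lemma. For the second, the induction again descends from
  \<open>n\<close>, and the hypothesis on \<open>F\<close> for row \<open>Suc y\<close> at
  \<open>k\<close> implies the one for row \<open>y\<close> at \<open>k - 1\<close>.\<close>

lemma rows_progress_sorted_rows:
  assumes "\<not> box_conflict n F" "y + t \<le> n" "y < n" "1 \<le> n"
  shows "rows_progress n F t y"
  using assms(2,3)
proof (induction y)
  case 0
  then show ?case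
    by (simp add: rows_progress_def)
next
  case (Suc y)
  then have IH: "rows_progress n F t y"
    by simp
  have "Suc y \<le> count_above t (sorted_rows n F (Suc y)) k"
    if "k \<le> n" "Suc y < k" "\<forall>(i, c)\<in>F. i \<le> Suc y \<and> c \<le> t \<longrightarrow> c \<le> k - Suc y" for k
    using that
  proof (induction k rule: inc_induct)
    case base
    show ?case
      using Suc.prems(1) count_above_sorted_rows_n[OF assms(4), of t F "Suc y"] by linarith
  next
    case (step k)
    show ?case
    proof (cases "t + y < k")
      \<comment> \<open>Here the identity already has \<open>k - t\<close> entries above
        \<open>t\<close> among the first \<open>k\<close> positions, and sorting loses none.\<close>
      case True
      then show ?thesis
        using count_above_sorted_rows_ge[of k t n F "Suc y"] by simp
    next
      case False
      \<comment> \<open>As \<open>k - y \<le> t\<close>, this box would force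
        \<open>k - y \<le> k - Suc y\<close>.\<close>
      then have "(Suc y, k - y) \<notin> F"
        using step.prems by fastforce
      then have "min (count_above t (sorted_rows n F y) (k - 1) + 1)
          (count_above t (sorted_rows n F (Suc y)) (Suc k))
          \<le> count_above t (sorted_rows n F (Suc y)) k"
        using step by (intro count_above_sorted_rows_step) simp_all
      moreover have "y \<le> count_above t (sorted_rows n F y) (k - 1)"
      proof -
        have "\<forall>(i, c)\<in>F. i \<le> y \<and> c \<le> t \<longrightarrow> c \<le> k - 1 - y"
          using step.prems by fastforce
        moreover have "y < k - 1" "k - 1 \<le> n"
          using step by simp_all
        ultimately show ?thesis
          using IH unfolding rows_progress_def by blast
      qed
      moreover have "Suc y \<le> count_above t (sorted_rows n F (Suc y)) (Suc k)"
        using step.prems by (intro step.IH) fastforce+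
      ultimately show ?thesis
        by linarith
    qed
  qed
  then show ?case
    using rows_progress_arrived[OF IH assms(1)] Suc.prems by (simp add: rows_progress_def)
qed

text \<open>Position \<open>1\<close> never receives an entry above \<open>t\<close>, because the
  letter \<open>1\<close> belongs to the box \<open>(1, 1)\<close> only; this gives the upper bound
  \<open>k - 1\<close>. The lower bound is the progress of the rows.\<close>

lemma count_above_sorted_rows_eq:
  assumes "\<not> box_conflict n F" "(1, 1) \<in> F" "1 \<le> t" "t \<le> n" "1 \<le> k" "k \<le> n"
  shows "count_above t (sorted_rows n F (n - 1)) k = min (k - 1) (n - t)"
proof (rule antisym)
  have "count_above t (sorted_rows n F (n - 1)) k \<le> count_above t (sorted_rows n F (n - 1)) n"
    using assms by (intro count_above_mono) simp
  moreover have "count_above t (sorted_rows n F (n - 1)) 1 = count_above t id 1"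
    unfolding sorted_rows_def
  proof (rule count_above_bubbles_notin[OF zero_notin_rows])
    have "1 \<notin> set (rows_word n F y)" for y
    proof (induction y)
      case (Suc y)
      have "1 \<notin> set (row_word n F (Suc y))"
        unfolding set_row_word[of "Suc y", simplified] using assms(2) by (cases y) auto
      with Suc show ?case
        by (simp add: rows_word_Suc)
    qed simp
    then show "1 \<notin> set (rows_word n F (n - 1))" .
  qed
  then have *: "\<not> t < sorted_rows n F (n - 1) 1"
    using assms(3) count_above_Suc[of t "sorted_rows n F (n - 1)" 0]
    by (simp only: count_above_id) (auto split: if_splits)
  have "count_above t (sorted_rows n F (n - 1)) k \<le> k - 1"
    using assms(5)
  proof (induction k rule: nat_induct_at_least)
    case base
    show ?case
      using * count_above_Suc[of t "sorted_rows n F (n - 1)" 0] by simp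
  next
    case (Suc k)
    then show ?case
      using count_above_Suc_le[of t "sorted_rows n F (n - 1)" k] by simp
  qed
  ultimately show "count_above t (sorted_rows n F (n - 1)) k \<le> min (k - 1) (n - t)"
    using count_above_sorted_rows_n[of n t F "n - 1"] assms by simp
next
  show "min (k - 1) (n - t) \<le> count_above t (sorted_rows n F (n - 1)) k"
  \<comment> \<open>All \<open>n - t\<close> entries have arrived after row
    \<open>n - t + 1\<close>, which for \<open>t = 1\<close> would be a row \<open>n\<close> that
    does not exist. In that case the bound after row \<open>n - 1\<close> settles every
    \<open>k < n\<close>, and \<open>k = n\<close> is the total count.\<close>
  proof (cases "t = 1")
    case True
    have *: "rows_progress n F t (n - 1)"
      using assms True by (intro rows_progress_sorted_rows) simp_all
    show ?thesis
    proof (cases "k = n")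
      case True
      then show ?thesis
        using count_above_sorted_rows_n[of n t F "n - 1"] assms by simp
    next
      case False
      then have "min (k - 1) (n - t) = min (k - 1) (n - 1 - 1)"
        using assms \<open>t = 1\<close> by simp
      with * assms show ?thesis
        by (simp only: rows_progress_def)
    qed
  next
    case False
    have "rows_progress n F t (n - t)"
      using assms by (intro rows_progress_sorted_rows) simp_all
    then have "min (k - 1) (n - t) \<le> count_above t (sorted_rows n F (Suc (n - t))) k"
      using assms False by (intro rows_progress_arrived) simp_all
    also have "\<dots> \<le> count_above t (sorted_rows n F (n - 1)) k"
      using assms False by (intro count_above_sorted_rows_mono) simp
    finally show ?thesis .
  qed
qed

lemma foldl_bubble_fixes:
  "set W \<subseteq> {1..n - 1} \<Longrightarrow> x \<notin> {1..n} \<Longrightarrow> foldl bubble id W x = x"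
proof (induction W rule: rev_induct)
  case (snoc k W)
  then have "x \<noteq> k" "x \<noteq> Suc k"
    by auto
  with snoc show ?case
    by (simp add: bubble_def simple_transposition_def)
qed simp

text \<open>Consecutive counts tell whether position \<open>m\<close> carries an entry above
  \<open>t\<close>. This pins the entry down: it lies above \<open>n + 1 - m\<close> but not above
  \<open>n + 2 - m\<close>.\<close>

lemma sorted_rows_eq_pi_perm:
  assumes "\<not> box_conflict n F" "(1, 1) \<in> F" "1 \<le> n"
  shows "sorted_rows n F (n - 1) = pi_perm n"
proof
  fix m
  let ?f = "sorted_rows n F (n - 1)"
  note c = count_above_sorted_rows_eq[OF assms(1,2)]
  have above: "t < ?f m \<longleftrightarrow> t + m < n + 2" if "1 \<le> t" "t \<le> n" "2 \<le> m" "m \<le> n" for t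
  proof -
    obtain l where l: "m = Suc l" "1 \<le> l"
      using \<open>2 \<le> m\<close> by (cases m) auto
    have "min l (n - t) = min (l - 1) (n - t) + (if t < ?f m then 1 else 0)"
      using count_above_Suc[of t ?f l] c[of t m] c[of t l] that l by simp
    then show ?thesis
      using that l by (auto simp: min_def split: if_splits)
  qed
  consider "m \<notin> {1..n}" | "m = 1" | "2 \<le> m" "m \<le> n"
    by fastforce
  then show "?f m = pi_perm n m"
  proof cases
    case 1
    then show ?thesis
      using foldl_bubble_fixes[OF set_rows_word 1, folded sorted_rows_def] by (auto simp: pi_perm_def)
  next
    case 2
    have "\<not> 1 < ?f 1"
      using c[of 1 1] count_above_Suc[of 1 ?f 0] assms(3) by (auto split: if_splits)
    \<comment> \<open>Threshold \<open>0\<close> shows that all entries in the positions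
      \<open>1\<close> to \<open>n\<close> are positive.\<close>
    moreover have "?f 1 \<noteq> 0"
    proof -
      have "count_above 0 ?f n = n"
        using count_above_sorted_rows_n[of n 0 F "n - 1"] assms(3) by simp
      then have "{x \<in> {1..n}. 0 < ?f x} = {1..n}"
        unfolding count_above_def by (intro card_subset_eq) auto
      then show ?thesis
        using assms(3) by fastforce
    qed
    ultimately show ?thesis
      using 2 by (simp add: pi_perm_def)
  next
    case 3
    have "n + 1 - m < ?f m"
      using above[of "n + 1 - m"] 3 by auto
    moreover have "\<not> n + 2 - m < ?f m"
      using above[of "n + 2 - m"] 3 by auto
    ultimately show ?thesis
      using 3 by (simp add: pi_perm_def)
  qed
qed

section \<open>Faces of the pipe dream complex of \<open>pi_perm n\<close>\<close>

lemma triangular_subword_antimono: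
  "F \<subseteq> G \<Longrightarrow> subseq (triangular_subword n (boxes n - G)) (triangular_subword n (boxes n - F))"
proof -
  assume "F \<subseteq> G"
  then have "filter (\<lambda>p. p \<in> boxes n - G) (reading_order n)
      = filter (\<lambda>p. p \<in> boxes n - G) (filter (\<lambda>p. p \<in> boxes n - F) (reading_order n))"
    unfolding filter_filter by (intro filter_cong) auto
  then show ?thesis
    unfolding triangular_subword_def by (simp only: subseq_map subseq_filter_left)
qed

theorem pipe_dream_complex_pi_perm:
  assumes "1 \<le> n"
  shows "pipe_dream_complex n (pi_perm n) = {F. F \<subseteq> boxes n \<and> \<not> box_conflict n F}"
proof (intro set_eqI iffI)
  fix F assume "F \<in> pipe_dream_complex n (pi_perm n)"
  then obtain ks where "F \<subseteq> boxes n" "subseq ks (triangular_subword n (boxes n - F))"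
    "word_product ks = pi_perm n"
    unfolding pipe_dream_complex_def reduced_word_def word_for_def by blast
  then show "F \<in> {F. F \<subseteq> boxes n \<and> \<not> box_conflict n F}"
    using pi_word_avoids_conflict by blast
next
  fix F assume "F \<in> {F. F \<subseteq> boxes n \<and> \<not> box_conflict n F}"
  then have F: "F \<subseteq> boxes n" "\<not> box_conflict n F"
    by auto
  \<comment> \<open>Greedy sorting must be kept from using the letter \<open>1\<close>, which moves
    the entry in position \<open>1\<close>. The box \<open>(1, 1)\<close> lies in no conflict, so it
    can be added to \<open>F\<close>; a reduced word that avoids it is also a subword for
    \<open>F\<close> itself.\<close>
  let ?F = "insert (1, 1) F"
  have "\<not> box_conflict n ?F"
  proof
    assume "box_conflict n ?F"
    then obtain i a j b where *: "(i, a) \<in> ?F" "(j, b) \<in> ?F" "i < j" "b < a" "j + a \<le> n + 1"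
      by (rule box_conflictE)
    have pos: "1 \<le> x \<and> 1 \<le> y" if "(x, y) \<in> ?F" for x y
    proof (cases "(x, y) = (1, 1)")
      case False
      with that have "(x, y) \<in> boxes n"
        using F(1) by blast
      then show ?thesis
        by (simp add: boxes_def)
    qed simp
    have "(i, a) \<noteq> (1, 1)" "(j, b) \<noteq> (1, 1)"
      using *(3,4) pos[OF *(1)] pos[OF *(2)] by simp_all
    then have "(i, a) \<in> F" "(j, b) \<in> F"
      using *(1,2) by blast+
    with * F(2) show False
      unfolding box_conflict_def by blast
  qed
  then have pi: "sorted_rows n ?F (n - 1) = pi_perm n"
    using assms by (intro sorted_rows_eq_pi_perm) auto
  obtain ks where ks: "subseq ks (rows_word n ?F (n - 1))" "pi_perm n = word_product ks"
    "card (inversions n (pi_perm n)) = length ks"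
    using bubble_reduced_subword[OF set_rows_word[of n ?F "n - 1"]]
    unfolding sorted_rows_def[symmetric] pi by blast
  have "word_for n (pi_perm n) ks"
    using subseq_set_subset[OF ks(1)] set_rows_word[of n ?F "n - 1"] ks(2) by (auto simp: word_for_def)
  then have "reduced_word n (pi_perm n) ks"
    using ks(3) by (rule reduced_wordI)
  moreover have "subseq ks (triangular_subword n (boxes n - F))"
    using subseq_order.order_trans[OF _ triangular_subword_antimono[of F ?F n]] ks(1)
    unfolding triangular_subword_eq_rows_word by blast
  ultimately show "F \<in> pipe_dream_complex n (pi_perm n)"
    using F(1) unfolding pipe_dream_complex_def by blast
qed

section \<open>Noncrossing alternating graphs\<close>

definition nc_alternating :: "nat \<Rightarrow> edges \<Rightarrow> bool" where
  "nc_alternating n G \<longleftrightarrow> G \<subseteq> complete_graph n \<and> noncrossing G \<and> alternating G"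

lemma finite_complete_graph [simp]: "finite (complete_graph n)"
  by (rule finite_subset[of _ "{1..n} \<times> {1..n}"]) (auto simp: complete_graph_def)

lemma mem_complete_graph: "(i, j) \<in> complete_graph n \<longleftrightarrow> 1 \<le> i \<and> i < j \<and> j \<le> n"
  by (simp add: complete_graph_def)

lemma nc_alternating_edge:
  assumes "nc_alternating n G" "(i, j) \<in> G"
  shows "1 \<le> i" "i < j" "j \<le> n"
proof -
  have "(i, j) \<in> complete_graph n"
    using assms unfolding nc_alternating_def by blast
  then show "1 \<le> i" "i < j" "j \<le> n"
    unfolding mem_complete_graph by simp_all
qed

lemma nc_alternating_crossing:
  assumes "nc_alternating n G" "(i, k) \<in> G" "(j, l) \<in> G" "i < j" "j < k" "k < l"
  shows False
  using assms unfolding nc_alternating_def noncrossing_def by blast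

lemma nc_alternating_path:
  assumes "nc_alternating n G" "(i, j) \<in> G" "(j, k) \<in> G"
  shows False
  using assms nc_alternating_edge[OF assms(1)] unfolding nc_alternating_def alternating_def by blast

lemma nc_alternatingI:
  assumes "\<And>i j. (i, j) \<in> G \<Longrightarrow> 1 \<le> i \<and> i < j \<and> j \<le> n"
    and "\<And>i j k l. (i, k) \<in> G \<Longrightarrow> (j, l) \<in> G \<Longrightarrow> i < j \<Longrightarrow> j < k \<Longrightarrow> k < l \<Longrightarrow> False"
    and "\<And>i j k. (i, j) \<in> G \<Longrightarrow> (j, k) \<in> G \<Longrightarrow> False"
  shows "nc_alternating n G"
proof -
  have "G \<subseteq> complete_graph n"
    using assms(1) by (auto simp: mem_complete_graph)
  moreover have "noncrossing G"
    unfolding noncrossing_def using assms(2) by blast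
  moreover have "alternating G"
    unfolding alternating_def using assms(3) by blast
  ultimately show ?thesis
    unfolding nc_alternating_def by blast
qed

lemma nc_alternating_subset: "nc_alternating n T \<Longrightarrow> G \<subseteq> T \<Longrightarrow> nc_alternating n G"
  unfolding nc_alternating_def noncrossing_def alternating_def by blast

lemma nc_alternating_singleton: "x \<in> complete_graph n \<Longrightarrow> nc_alternating n {x}"
  by (rule nc_alternatingI) (auto simp: complete_graph_def)

section \<open>Noncrossing alternating graphs have no cycles\<close>

lemma graph_cycle_neighbours:
  assumes "graph_cycle G c" "v \<in> set c"
  obtains u w where "u \<in> set c" "w \<in> set c" "u \<noteq> w" "adjacent G v u" "adjacent G v w"
proof -
  let ?L = "length c"
  have L: "?L \<ge> 3" and d: "distinct c" and s: "successively (adjacent G) (c @ [hd c])"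
    using assms(1) unfolding graph_cycle_def by simp_all
  obtain i where i: "i < ?L" "v = c ! i"
    using assms(2) by (metis in_set_conv_nth)
  have adj: "adjacent G ((c @ [hd c]) ! k) ((c @ [hd c]) ! Suc k)" if "k < ?L" for k
    using s that unfolding successively_conv_nth by simp
  have hd: "hd c = c ! 0"
    using L by (intro hd_conv_nth) auto
  \<comment> \<open>Cyclic successor and predecessor of the index \<open>i\<close>; a length of at
    least \<open>3\<close> makes them different.\<close>
  define a where "a = (if Suc i = ?L then 0 else Suc i)"
  define b where "b = (if i = 0 then ?L - 1 else i - 1)"
  have ab: "a < ?L" "b < ?L" "a \<noteq> b"
    using i L by (auto simp: a_def b_def)
  have "adjacent G v (c ! a)"
    using adj[of i] i hd by (auto simp: a_def nth_append)
  moreover have "adjacent G v (c ! b)"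
  proof (cases "i = 0")
    case True
    have "adjacent G (c ! (?L - 1)) (c ! 0)"
    proof -
      have "Suc (?L - 1) = ?L" "?L - 1 < ?L"
        using L by simp_all
      then show ?thesis
        using adj[of "?L - 1"] hd by (simp add: nth_append)
    qed
    with True show ?thesis
      unfolding i(2) by (simp add: b_def adjacent_def disj_commute)
  next
    case False
    have "adjacent G (c ! (i - 1)) (c ! i)"
      using adj[of "i - 1"] False i by (auto simp: nth_append)
    with False show ?thesis
      unfolding i(2) by (simp add: b_def adjacent_def disj_commute)
  qed
  moreover have "c ! a \<noteq> c ! b"
    using ab d by (simp add: nth_eq_iff_index_eq)
  ultimately show ?thesis
    using that[of "c ! a" "c ! b"] ab by simp
qed

text \<open>In a cycle, the smallest sink \<open>j\<close> has two sources below it; the larger one is also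
  joined to a sink beyond \<open>j\<close>, which gives a crossing.\<close>

lemma nc_alternating_acyclic:
  assumes G: "nc_alternating n G"
  shows "\<not> graph_cycle G c"
proof
  assume c: "graph_cycle G c"
  define sinks where "sinks = {v \<in> set c. \<exists>u. (u, v) \<in> G}"
  have below: "u < v \<and> (u, v) \<in> G" if "v \<in> sinks" "adjacent G v u" for u v
    using that nc_alternating_path[OF G] nc_alternating_edge(2)[OF G]
    unfolding sinks_def adjacent_def by blast
  have "c \<noteq> []"
    using c unfolding graph_cycle_def by auto
  then have "hd c \<in> set c"
    by simp
  then obtain u where u: "u \<in> set c" "adjacent G (hd c) u"
    using graph_cycle_neighbours[OF c] by metis
  then have "hd c \<in> sinks \<or> u \<in> sinks"
    using \<open>hd c \<in> set c\<close> unfolding sinks_def adjacent_def by blast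
  moreover have "finite sinks"
    by (simp add: sinks_def)
  ultimately obtain j where j: "j \<in> sinks" "\<And>v. v \<in> sinks \<Longrightarrow> j \<le> v"
    using Min_in[of sinks] Min_le[of sinks] by blast
  then have "j \<in> set c"
    by (simp add: sinks_def)
  then obtain u w where uw: "u \<in> set c" "w \<in> set c" "u \<noteq> w" "adjacent G j u" "adjacent G j w"
    using graph_cycle_neighbours[OF c] by metis
  obtain a b where ab: "b \<in> set c" "a < b" "(a, j) \<in> G" "(b, j) \<in> G" "b < j"
    using uw below[OF j(1)] by (metis linorder_neqE_nat)
  have "j \<le> v \<and> (b, v) \<in> G" if "v \<in> set c" "adjacent G b v" for v
  proof -
    have "(b, v) \<in> G"
      using that(2) ab(4) nc_alternating_path[OF G] unfolding adjacent_def by blast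
    then have "v \<in> sinks"
      using that(1) unfolding sinks_def by blast
    with j(2) \<open>(b, v) \<in> G\<close> show ?thesis
      by simp
  qed
  \<comment> \<open>Of the two neighbours of \<open>b\<close> at least one is not
    \<open>j\<close>.\<close>
  then obtain v where "j < v" "(b, v) \<in> G"
    using graph_cycle_neighbours[OF c ab(1)] by (metis le_neq_implies_less)
  with ab show False
    using nc_alternating_crossing[OF G] by blast
qed

section \<open>Maximal graphs are spanning trees\<close>

lemma rtranclp_adjacent_sym: "(adjacent G)\<^sup>*\<^sup>* u v \<Longrightarrow> (adjacent G)\<^sup>*\<^sup>* v u"
proof (induction rule: rtranclp_induct)
  case (step v w)
  then have "adjacent G w v"
    unfolding adjacent_def by blast
  then show ?case
    using step.IH by (rule converse_rtranclp_into_rtranclp)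
qed simp

text \<open>If the outermost edges below \<open>(p, q)\<close> at \<open>p\<close> and at \<open>q\<close> left a vertex \<open>m\<close> uncovered
  just before the latter, the edge \<open>(p, m)\<close> could be added.\<close>

lemma maximal_nc_alternating_interval:
  assumes G: "nc_alternating n G"
    and maximal: "\<And>x. x \<in> complete_graph n \<Longrightarrow> nc_alternating n (insert x G) \<Longrightarrow> x \<in> G"
    and "(p, q) \<in> G" "p \<le> v" "v \<le> q"
  shows "(adjacent G)\<^sup>*\<^sup>* p v"
  using assms(3-5)
proof (induction "q - p" arbitrary: p q v rule: less_induct)
  case less
  note cross = nc_alternating_crossing[OF G] and path = nc_alternating_path[OF G]
    and edge = nc_alternating_edge[OF G]
  have pq: "1 \<le> p" "p < q" "q \<le> n"
    using edge[OF less.prems(1)] by simp_all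
  \<comment> \<open>Including \<open>p\<close> in \<open>L\<close> and \<open>q\<close> in
    \<open>R\<close> covers the case that no shorter edge starts at \<open>p\<close> or ends at
    \<open>q\<close>.\<close>
  define L where "L = {y. (y = p \<or> (p, y) \<in> G) \<and> y < q}"
  define R where "R = {x. (x = q \<or> (x, q) \<in> G) \<and> p < x \<and> x \<le> q}"
  have fin: "finite L" "finite R" and ne: "p \<in> L" "q \<in> R"
    unfolding L_def R_def using pq by simp_all
  obtain l where l: "l \<in> L" "\<And>y. y \<in> L \<Longrightarrow> y \<le> l"
    using Max_in[OF fin(1)] Max_ge[OF fin(1)] ne by blast
  obtain r where r: "r \<in> R" "\<And>x. x \<in> R \<Longrightarrow> r \<le> x"
    using Min_in[OF fin(2)] Min_le[OF fin(2)] ne by blast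
  have l': "l = p \<or> (p, l) \<in> G" "l < q" "p \<le> l"
    using l ne unfolding L_def by auto
  have r': "r = q \<or> (r, q) \<in> G" "p < r" "r \<le> q"
    using r unfolding R_def by auto
  have "l < r"
  proof (rule ccontr)
    assume "\<not> l < r"
    then have "l \<noteq> p" "r \<noteq> q" "r \<le> l"
      using l' r' by linarith+
    then have "(p, l) \<in> G" "(r, q) \<in> G"
      using l' r' by blast+
    then show False
      using cross[of p l r q] path[of p l q] \<open>r \<le> l\<close> l' r' by (cases "r = l") auto
  qed
  have "r = Suc l"
  proof (rule ccontr)
    assume "r \<noteq> Suc l"
    define m where "m = r - 1"
    have m: "l < m" "Suc m = r" "p < m" "m < q"
      using \<open>l < r\<close> \<open>r \<noteq> Suc l\<close> l' r' by (simp_all add: m_def)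
    \<comment> \<open>Such an edge is the only obstruction to adding \<open>(p, m)\<close> that
      \<open>(p, q)\<close> itself does not exclude. It would cross \<open>(p, q)\<close>, undercut
      \<open>r\<close> in \<open>R\<close>, or form a crossing or a path with
      \<open>(r, q)\<close>.\<close>
    have none: False if jk: "(j, k) \<in> G" "p < j" "j \<le> m" "m < k" for j k
    proof -
      consider "q < k" | "q = k" | "k < q" "r \<le> k"
        using jk(4) m(2) by linarith
      then show False
      proof cases
        case 1
        then show ?thesis
          using cross[OF less.prems(1) jk(1)] jk m by simp
      next
        case 2
        then have "j \<in> R"
          using jk m unfolding R_def by simp
        then show ?thesis
          using r(2)[of j] jk m by simp
      next
        case 3
        then have "(r, q) \<in> G"
          using r' by auto
        then show ?thesis
          using path[of j r q] cross[of j k r q] jk 3 m by (cases "k = r") auto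
      qed
    qed
    have "nc_alternating n (insert (p, m) G)"
    proof (rule nc_alternatingI)
      show "1 \<le> i \<and> i < j \<and> j \<le> n" if "(i, j) \<in> insert (p, m) G" for i j
        using that edge[of i j] m pq by auto
    next
      fix i j k l
      assume *: "(i, k) \<in> insert (p, m) G" "(j, l) \<in> insert (p, m) G" "i < j" "j < k" "k < l"
      consider "(i, k) \<in> G" "(j, l) \<in> G" | "i = p" "k = m" "(j, l) \<in> G" | "(i, k) \<in> G" "j = p" "l = m"
        using * by auto
      then show False
      proof cases
        case 1
        then show ?thesis using cross * by blast
      next
        case 2
        then show ?thesis using none[of j l] * by simp
      next
        case 3
        then show ?thesis using cross[of i k p q] less.prems(1) * m by simp
      qed
    next
      fix i j k
      assume *: "(i, j) \<in> insert (p, m) G" "(j, k) \<in> insert (p, m) G"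
      consider "(i, j) \<in> G" "(j, k) \<in> G" | "j = m" "(j, k) \<in> G" | "(i, j) \<in> G" "j = p" | "p = m"
        using * by auto
      then show False
      proof cases
        case 1
        then show ?thesis using path by blast
      next
        case 2
        then show ?thesis using none[of m k] m edge[of m k] by simp
      next
        case 3
        then show ?thesis using path[of i p q] less.prems(1) by simp
      qed (use m in simp)
    qed
    then have "(p, m) \<in> G"
      using m pq by (intro maximal) (simp_all add: mem_complete_graph)
    then have "m \<in> L"
      using m unfolding L_def by simp
    then show False
      using l(2)[of m] m by simp
  qed
  have left: "(adjacent G)\<^sup>*\<^sup>* p w" if "p \<le> w" "w \<le> l" for w
  proof (cases "l = p")
    case True
    with that show ?thesis by simp
  next
    case False
    then show ?thesis
      using less.hyps[of l p w] that l' by simp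
  qed
  have right: "(adjacent G)\<^sup>*\<^sup>* r w" if "r \<le> w" "w \<le> q" for w
  proof (cases "r = q")
    case True
    with that show ?thesis by simp
  next
    case False
    then show ?thesis
      using less.hyps[of q r w] that r' by simp
  qed
  show ?case
  proof (cases "v \<le> l")
    case True
    then show ?thesis using left less.prems by simp
  next
    case False
    \<comment> \<open>Vertices beyond \<open>l\<close> are reached by the edge
      \<open>(p, q)\<close>, then back to \<open>r\<close> and on to \<open>v\<close> inside the
      interval from \<open>r\<close> to \<open>q\<close>.\<close>
    have "(adjacent G)\<^sup>*\<^sup>* p q"
      using less.prems(1) by (intro r_into_rtranclp) (simp add: adjacent_def)
    also have "(adjacent G)\<^sup>*\<^sup>* q r"
      using rtranclp_adjacent_sym[OF right[of q]] r' by simp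
    also have "(adjacent G)\<^sup>*\<^sup>* r v"
      using right[of v] False \<open>r = Suc l\<close> less.prems by simp
    finally show ?thesis .
  qed
qed

text \<open>The edge \<open>(1, n)\<close> neither crosses an edge nor extends to a path of two
  edges, so a maximal graph contains it; connectedness is then the interval lemma for
  \<open>(1, n)\<close>.\<close>

lemma maximal_nc_alternating_spanning_tree:
  assumes "2 \<le> n" and G: "nc_alternating n G"
    and maximal: "\<And>x. x \<in> complete_graph n \<Longrightarrow> nc_alternating n (insert x G) \<Longrightarrow> x \<in> G"
  shows "spanning_tree n G"
proof -
  note edge = nc_alternating_edge[OF G]
  have "nc_alternating n (insert (1, n) G)"
  proof (rule nc_alternatingI)
    show "1 \<le> i \<and> i < j \<and> j \<le> n" if "(i, j) \<in> insert (1, n) G" for i j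
      using that edge[of i j] assms(1) by auto
  next
    fix i j k l
    assume "(i, k) \<in> insert (1, n) G" "(j, l) \<in> insert (1, n) G" "i < j" "j < k" "k < l"
    then show False
      using edge[of i k] edge[of j l] nc_alternating_crossing[OF G, of i k j l] by auto
  next
    fix i j k
    assume "(i, j) \<in> insert (1, n) G" "(j, k) \<in> insert (1, n) G"
    then show False
      using edge[of i j] edge[of j k] nc_alternating_path[OF G, of i j k] assms(1) by auto
  qed
  then have "(1, n) \<in> G"
    using assms(1) by (intro maximal) (simp_all add: mem_complete_graph)
  then have "(adjacent G)\<^sup>*\<^sup>* 1 v" if "v \<in> {1..n}" for v
    using that by (intro maximal_nc_alternating_interval[OF G maximal]) auto
  then have "connected_graph n G"
    unfolding connected_graph_def by (meson rtranclp_adjacent_sym rtranclp_trans)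
  then show ?thesis
    using nc_alternating_acyclic[OF G] G unfolding spanning_tree_def nc_alternating_def by blast
qed

text \<open>A maximal extension of the graph serves as the tree. Simplices of the triangulation can
  thus be indexed by all noncrossing alternating graphs.\<close>

lemma nc_alternating_iff_tree_subgraph:
  assumes "2 \<le> n"
  shows "nc_alternating n G \<longleftrightarrow>
    (\<exists>T. spanning_tree n T \<and> noncrossing T \<and> alternating T \<and> G \<subseteq> T)"
proof
  assume G: "nc_alternating n G"
  let ?A = "{T. nc_alternating n T}"
  have "finite ?A"
    by (rule finite_subset[of _ "Pow (complete_graph n)"]) (auto simp: nc_alternating_def)
  moreover have "G \<in> ?A"
    using G by simp
  ultimately have "\<exists>T\<in>?A. G \<subseteq> T \<and> (\<forall>S\<in>?A. T \<subseteq> S \<longrightarrow> T = S)"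
    by (rule finite_has_maximal2)
  then obtain T where T: "nc_alternating n T" "G \<subseteq> T" "\<forall>S\<in>?A. T \<subseteq> S \<longrightarrow> T = S"
    by (elim bexE conjE) simp
  have "spanning_tree n T"
  proof (rule maximal_nc_alternating_spanning_tree[OF assms T(1)])
    fix x assume "nc_alternating n (insert x T)"
    then have "T = insert x T"
      using bspec[OF T(3), of "insert x T"] subset_insertI[of T x] by simp
    then show "x \<in> T"
      by blast
  qed
  with T(1) show "\<exists>T. spanning_tree n T \<and> noncrossing T \<and> alternating T \<and> G \<subseteq> T"
    using T(2) unfolding nc_alternating_def by blast
next
  assume "\<exists>T. spanning_tree n T \<and> noncrossing T \<and> alternating T \<and> G \<subseteq> T"
  then obtain T where "spanning_tree n T" "noncrossing T" "alternating T" "G \<subseteq> T"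
    by blast
  then show "nc_alternating n G"
    by (intro nc_alternating_subset[of n T G]) (simp_all add: spanning_tree_def nc_alternating_def)
qed

text \<open>The coordinates of the combination of roots with coefficients \<open>c\<close>, read as
  the divergence of a flow along the edges from smaller to larger vertices.\<close>

definition net_flow :: "nat \<Rightarrow> (nat \<times> nat \<Rightarrow> real) \<Rightarrow> nat \<Rightarrow> real" where
  "net_flow n c v =
     (\<Sum>x\<in>complete_graph n. c x * (of_bool (fst x = v) - of_bool (snd x = v)))"

lemma net_flow_diff: "net_flow n (\<lambda>x. c x - d x) v = net_flow n c v - net_flow n d v"
  by (simp add: net_flow_def left_diff_distrib sum_subtractf)

text \<open>Alternation keeps a vertex with an outgoing edge free of incoming ones, so nothing
  cancels and the sign of the net flow tells sources from sinks.\<close>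

lemma net_flow_pos_iff:
  assumes S: "nc_alternating n {x. c x \<noteq> 0}" and pos: "\<And>x. (0::real) \<le> c x"
  shows "0 < net_flow n c v \<longleftrightarrow> (\<exists>w. c (v, w) \<noteq> 0)"
proof
  assume gt: "0 < net_flow n c v"
  show "\<exists>w. c (v, w) \<noteq> 0"
  proof (rule ccontr)
    assume "\<nexists>w. c (v, w) \<noteq> 0"
    then have "net_flow n c v \<le> 0"
      unfolding net_flow_def using pos by (intro sum_nonpos) (auto simp: mult_nonneg_nonpos)
    with gt show False by simp
  qed
next
  assume "\<exists>w. c (v, w) \<noteq> 0"
  then obtain w where w: "c (v, w) \<noteq> 0" by blast
  then have vw: "(v, w) \<in> complete_graph n"
    using S unfolding nc_alternating_def by blast
  have "c (u, v) = 0" for u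
    using nc_alternating_path[OF S, of u v w] w by auto
  then have ge: "0 \<le> c x * (of_bool (fst x = v) - of_bool (snd x = v))" for x
    using pos[of x] by (cases x) auto
  have gt: "0 < c (v, w) * (of_bool (fst (v, w) = v) - of_bool (snd (v, w) = v))"
    using w pos[of "(v, w)"] vw by (auto simp: mem_complete_graph less_le)
  show "0 < net_flow n c v"
    unfolding net_flow_def by (rule sum_pos2[OF finite_complete_graph vw]) (rule gt, rule ge)
qed

lemma net_flow_neg_iff:
  assumes S: "nc_alternating n {x. c x \<noteq> 0}" and pos: "\<And>x. (0::real) \<le> c x"
  shows "net_flow n c v < 0 \<longleftrightarrow> (\<exists>u. c (u, v) \<noteq> 0)"
proof
  assume lt: "net_flow n c v < 0"
  show "\<exists>u. c (u, v) \<noteq> 0"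
  proof (rule ccontr)
    assume "\<nexists>u. c (u, v) \<noteq> 0"
    then have "0 \<le> net_flow n c v"
      unfolding net_flow_def using pos by (intro sum_nonneg) auto
    with lt show False by simp
  qed
next
  assume "\<exists>u. c (u, v) \<noteq> 0"
  then obtain u where u: "c (u, v) \<noteq> 0" by blast
  then have uv: "(u, v) \<in> complete_graph n"
    using S unfolding nc_alternating_def by blast
  have "c (v, w) = 0" for w
    using nc_alternating_path[OF S, of u v w] u by auto
  then have ge: "0 \<le> - (c x * (of_bool (fst x = v) - of_bool (snd x = v)))" for x
    using pos[of x] by (cases x) auto
  have gt: "0 < - (c (u, v) * (of_bool (fst (u, v) = v) - of_bool (snd (u, v) = v)))"
    using u pos[of "(u, v)"] uv by (auto simp: mem_complete_graph less_le)
  have "0 < (\<Sum>x\<in>complete_graph n. - (c x * (of_bool (fst x = v) - of_bool (snd x = v))))"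
    by (rule sum_pos2[OF finite_complete_graph uv]) (rule gt, rule ge)
  then show "net_flow n c v < 0"
    by (simp add: net_flow_def sum_negf)
qed

text \<open>An edge into \<open>j\<close> starts at some \<open>u \<le> i\<close>, and an edge out
  of \<open>i\<close> ends at some \<open>w \<ge> j\<close>; unless one of them is
  \<open>(i, j)\<close>, they cross.\<close>

lemma nc_alternating_matching_edge:
  assumes S: "nc_alternating n {x. c x \<noteq> 0}" and pos: "\<And>x. (0::real) \<le> c x"
    and j: "net_flow n c j < 0" "\<And>v. net_flow n c v < 0 \<Longrightarrow> j \<le> v"
    and i: "0 < net_flow n c i" "i < j" "\<And>v. 0 < net_flow n c v \<Longrightarrow> v < j \<Longrightarrow> v \<le> i"
  shows "c (i, j) \<noteq> 0"
proof -
  note pos_iff = net_flow_pos_iff[OF S pos] and neg_iff = net_flow_neg_iff[OF S pos]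
  obtain u where u: "c (u, j) \<noteq> 0"
    using j(1) neg_iff by blast
  obtain w where w: "c (i, w) \<noteq> 0"
    using i(1) pos_iff by blast
  have "u < j"
    using nc_alternating_edge(2)[OF S, of u j] u by simp
  then have "u \<le> i"
    using i(3) pos_iff u by blast
  have "j \<le> w"
    using j(2) neg_iff w by blast
  show ?thesis
  proof (cases "u = i \<or> w = j")
    case True
    with u w show ?thesis by auto
  next
    case False
    then show ?thesis
      using nc_alternating_crossing[OF S, of u j i w] u w \<open>u \<le> i\<close> \<open>j \<le> w\<close> i(2) by simp
  qed
qed

text \<open>A noncrossing alternating flow matches the first sink with the last source before it, so
  that two such flows with the same net flow agree: subtract the common part on this edge.\<close>

lemma nc_alternating_flow_unique:
  assumes "nc_alternating n {x. c x \<noteq> 0}" "\<And>x. (0::real) \<le> c x"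
    and "nc_alternating n {x. d x \<noteq> 0}" "\<And>x. (0::real) \<le> d x"
    and "\<And>v. net_flow n c v = net_flow n d v"
  shows "c = d"
  using assms
proof (induction "card {x. c x \<noteq> 0} + card {x. d x \<noteq> 0}" arbitrary: c d rule: less_induct)
  case less
  note C = less.prems(1,2) and D = less.prems(3,4) and net = less.prems(5)
  have fin: "finite {x. c x \<noteq> 0}" "finite {x. d x \<noteq> 0}"
    using C(1) D(1) finite_subset[OF _ finite_complete_graph] unfolding nc_alternating_def by metis+
  show ?case
  proof (cases "\<exists>v. net_flow n c v < 0")
    case False
    have "c (u, v) = 0" "d (u, v) = 0" for u v
      using net_flow_neg_iff[OF C, of v] net_flow_neg_iff[OF D, of v] False net by auto
    then show ?thesis
      by (intro ext) (metis surj_pair)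
  next
    case True
    define j where "j = (LEAST v. net_flow n c v < 0)"
    have j: "net_flow n c j < 0" "\<And>v. net_flow n c v < 0 \<Longrightarrow> j \<le> v"
      unfolding j_def using True by (auto intro: LeastI_ex Least_le)
    let ?I = "{v. v < j \<and> 0 < net_flow n c v}"
    obtain u where u: "c (u, j) \<noteq> 0"
      using j(1) net_flow_neg_iff[OF C] by blast
    then have "u \<in> ?I"
      using nc_alternating_edge(2)[OF C(1), of u j] net_flow_pos_iff[OF C] by auto
    moreover have "finite ?I"
      by simp
    ultimately obtain i where i: "0 < net_flow n c i" "i < j"
      "\<And>v. 0 < net_flow n c v \<Longrightarrow> v < j \<Longrightarrow> v \<le> i"
      using Max_in[of ?I] Max_ge[of ?I] by blast
    have "c (i, j) \<noteq> 0"
      using nc_alternating_matching_edge[OF C j i] .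
    \<comment> \<open>The sources and sinks of \<open>d\<close> are those of \<open>c\<close>, being
      read off from the net flow.\<close>
    moreover have "d (i, j) \<noteq> 0"
      using nc_alternating_matching_edge[OF D j[unfolded net] i[unfolded net]] .
    ultimately have ij: "0 < c (i, j)" "0 < d (i, j)"
      using C(2)[of "(i, j)"] D(2)[of "(i, j)"] by simp_all
    \<comment> \<open>Subtracting the smaller value clears \<open>(i, j)\<close> from at least one
      of the supports and enlarges neither, so the total support size drops.\<close>
    define m where "m = min (c (i, j)) (d (i, j))"
    define e where "e x = (if x = (i, j) then m else 0)" for x
    have m: "0 < m" "m \<le> c (i, j)" "m \<le> d (i, j)" "m = c (i, j) \<or> m = d (i, j)"
      using ij by (auto simp: m_def)
    have sub: "{x. c x - e x \<noteq> 0} \<subseteq> {x. c x \<noteq> 0}" "{x. d x - e x \<noteq> 0} \<subseteq> {x. d x \<noteq> 0}"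
      using ij by (auto simp: e_def split: if_splits)
    have "card {x. c x - e x \<noteq> 0} + card {x. d x - e x \<noteq> 0}
        < card {x. c x \<noteq> 0} + card {x. d x \<noteq> 0}"
      using m(4)
    proof
      assume "m = c (i, j)"
      then have "(i, j) \<notin> {x. c x - e x \<noteq> 0}"
        by (simp add: e_def)
      moreover have "(i, j) \<in> {x. c x \<noteq> 0}"
        using ij by simp
      ultimately have "{x. c x - e x \<noteq> 0} \<subset> {x. c x \<noteq> 0}"
        using sub(1) by (intro psubsetI) auto
      then show ?thesis
        by (intro add_less_le_mono psubset_card_mono card_mono fin sub)
    next
      assume "m = d (i, j)"
      then have "(i, j) \<notin> {x. d x - e x \<noteq> 0}"
        by (simp add: e_def)
      moreover have "(i, j) \<in> {x. d x \<noteq> 0}"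
        using ij by simp
      ultimately have "{x. d x - e x \<noteq> 0} \<subset> {x. d x \<noteq> 0}"
        using sub(2) by (intro psubsetI) auto
      then show ?thesis
        by (intro add_le_less_mono psubset_card_mono card_mono fin sub)
    qed
    then have "(\<lambda>x. c x - e x) = (\<lambda>x. d x - e x)"
    proof (rule less.hyps)
      show "nc_alternating n {x. c x - e x \<noteq> 0}" "nc_alternating n {x. d x - e x \<noteq> 0}"
        using nc_alternating_subset[OF C(1) sub(1)] nc_alternating_subset[OF D(1) sub(2)] .
      show "0 \<le> c x - e x" "0 \<le> d x - e x" for x
        using m C(2)[of x] D(2)[of x] by (auto simp: e_def)
      show "net_flow n (\<lambda>x. c x - e x) v = net_flow n (\<lambda>x. d x - e x) v" for v
        using net by (simp add: net_flow_diff)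
    qed
    then have "c x - e x = d x - e x" for x
      by (rule fun_cong)
    then show ?thesis
      by auto
  qed
qed

section \<open>Root cones and root polytopes\<close>

locale basis_enumeration =
  fixes e :: "nat \<Rightarrow> 'a::euclidean_space" and n :: nat
  assumes basis: "bij_betw e {1..n} Basis"
begin

lemma inner_basis:
  assumes "i \<in> {1..n}" "j \<in> {1..n}"
  shows "e i \<bullet> e j = of_bool (i = j)"
proof -
  have "e i \<in> Basis" "e j \<in> Basis" "e i = e j \<longleftrightarrow> i = j"
    using basis assms by (auto simp: bij_betw_def inj_on_eq_iff)
  then show ?thesis
    by (simp add: inner_Basis)
qed

lemma inner_root:
  assumes "v \<in> {1..n}" "x \<in> complete_graph n"
  shows "e v \<bullet> root e x = of_bool (fst x = v) - of_bool (snd x = v)"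
proof -
  obtain i j where x: "x = (i, j)" by fastforce
  then have "i \<in> {1..n}" "j \<in> {1..n}"
    using assms(2) by (auto simp: mem_complete_graph)
  then show ?thesis
    using assms(1) by (auto simp: x root_def inner_diff_right inner_basis)
qed

lemma inner_root_sum:
  assumes "v \<in> {1..n}"
  shows "e v \<bullet> (\<Sum>x\<in>complete_graph n. c x *\<^sub>R root e x) = net_flow n c v"
  using assms by (simp add: inner_sum_right inner_root net_flow_def)

lemma net_flow_outside: "v \<notin> {1..n} \<Longrightarrow> net_flow n c v = 0"
  unfolding net_flow_def by (intro sum.neutral) (auto simp: complete_graph_def)

text \<open>Taking coordinates turns the equation into equality of net flows. Extension by zero lets
  the two graphs differ: coefficients agree on common edges and vanish on all others.\<close>

lemma root_sum_unique:
  assumes "nc_alternating n G" "\<And>x. x \<in> G \<Longrightarrow> 0 \<le> c x"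
    and "nc_alternating n G'" "\<And>x. x \<in> G' \<Longrightarrow> 0 \<le> d x"
    and eq: "(\<Sum>x\<in>G. c x *\<^sub>R root e x) = (\<Sum>x\<in>G'. d x *\<^sub>R root e x)"
  shows "(if x \<in> G then c x else 0) = (if x \<in> G' then d x else 0)"
proof -
  have ext: "(\<Sum>x\<in>F. h x *\<^sub>R root e x)
      = (\<Sum>x\<in>complete_graph n. (if x \<in> F then h x else 0) *\<^sub>R root e x)"
    if "nc_alternating n F" for F h
    using that unfolding nc_alternating_def by (intro sum.mono_neutral_cong_left) auto
  have sub: "{x. (if x \<in> F then h x else 0) \<noteq> 0} \<subseteq> F" for F :: edges and h :: "nat \<times> nat \<Rightarrow> real"
    by (auto split: if_splits)
  have "net_flow n (\<lambda>x. if x \<in> G then c x else 0) v = net_flow n (\<lambda>x. if x \<in> G' then d x else 0) v"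
    for v
  proof (cases "v \<in> {1..n}")
    case True
    then show ?thesis
      using eq unfolding ext[OF assms(1)] ext[OF assms(3)] inner_root_sum[OF True, symmetric] by simp
  next
    case False
    then show ?thesis
      by (simp add: net_flow_outside)
  qed
  then have "(\<lambda>x. if x \<in> G then c x else 0) = (\<lambda>x. if x \<in> G' then d x else 0)"
    using assms nc_alternating_subset[OF assms(1) sub] nc_alternating_subset[OF assms(3) sub]
    by (intro nc_alternating_flow_unique[of n]) auto
  then show ?thesis
    by (rule fun_cong)
qed

text \<open>A positive root is itself a combination supported on a single edge, so uniqueness puts
  that edge into \<open>G\<close>.\<close>

lemma positive_roots_Int_root_cone:
  assumes G: "nc_alternating n G"
  shows "positive_roots e n \<inter> root_cone e G = root e ` G"
proof (intro equalityI subsetI)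
  fix y assume y: "y \<in> positive_roots e n \<inter> root_cone e G"
  then obtain x where x: "x \<in> complete_graph n" "y = root e x"
    by (auto simp: positive_roots_def)
  obtain c where c: "\<forall>x\<in>G. 0 \<le> c x" "y = (\<Sum>x\<in>G. c x *\<^sub>R root e x)"
    using y by (auto simp: root_cone_def)
  have "(\<Sum>x\<in>G. c x *\<^sub>R root e x) = (\<Sum>x\<in>{x}. 1 *\<^sub>R root e x)"
    using c(2) x(2) by simp
  from root_sum_unique[OF G _ nc_alternating_singleton[OF x(1)] _ this, of x]
  have "x \<in> G"
    using c(1) by (auto split: if_splits)
  then show "y \<in> root e ` G"
    using x by blast
next
  fix y assume "y \<in> root e ` G"
  then obtain x where x: "x \<in> G" "y = root e x" by blast
  have fin: "finite G" and sub: "G \<subseteq> complete_graph n"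
    using G finite_subset[OF _ finite_complete_graph] by (auto simp: nc_alternating_def)
  have "(\<Sum>z\<in>G. of_bool (z = x) *\<^sub>R root e z) = (\<Sum>z\<in>G. if z = x then root e z else 0)"
    by (intro sum.cong) auto
  also have "\<dots> = y"
    using x fin by simp
  finally have "y = (\<Sum>z\<in>G. of_bool (z = x) *\<^sub>R root e z)"
    by simp
  then have "y \<in> root_cone e G"
    unfolding root_cone_def by (intro CollectI exI[of _ "\<lambda>z. of_bool (z = x)"]) auto
  then show "y \<in> positive_roots e n \<inter> root_cone e G"
    using x sub by (auto simp: positive_roots_def)
qed

text \<open>Each positive root is a telescoping sum of roots of consecutive vertices. Hence the
  polytope of the path is the hull of \<open>0\<close> and all positive roots.\<close>

lemma positive_roots_subset_root_cone_path: "positive_roots e n \<subseteq> root_cone e (path_graph n)"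
proof
  fix y assume "y \<in> positive_roots e n"
  then obtain i j where ij: "1 \<le> i" "i < j" "j \<le> n" "y = e i - e j"
    by (auto simp: positive_roots_def mem_complete_graph root_def complete_graph_def)
  let ?c = "\<lambda>x. of_bool (i \<le> fst x \<and> fst x < j) :: real"
  have path: "path_graph n = (\<lambda>k. (k, Suc k)) ` {1..n - 1}"
    by (auto simp: path_graph_def)
  have "(\<Sum>x\<in>path_graph n. ?c x *\<^sub>R root e x)
      = (\<Sum>k\<in>{1..n - 1}. of_bool (i \<le> k \<and> k < j) *\<^sub>R (e k - e (Suc k)))"
    unfolding path by (subst sum.reindex) (auto simp: inj_on_def root_def)
  also have "\<dots> = (\<Sum>k\<in>{i..<j}. e k - e (Suc k))"
    using ij by (intro sum.mono_neutral_cong_right) auto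
  also have "\<dots> = - (\<Sum>k\<in>{i..<j}. e (Suc k) - e k)"
    by (simp flip: sum_negf)
  also have "\<dots> = y"
    using ij by (simp add: sum_Suc_diff')
  finally have "y = (\<Sum>x\<in>path_graph n. ?c x *\<^sub>R root e x)"
    by simp
  then show "y \<in> root_cone e (path_graph n)"
    unfolding root_cone_def by (intro CollectI exI[of _ ?c]) auto
qed

lemma root_polytope_path: "root_polytope e n (path_graph n) = convex hull (insert 0 (positive_roots e n))"
  using positive_roots_subset_root_cone_path by (simp add: root_polytope_def Int_absorb2)

lemma root_polytope_nc_alternating:
  "nc_alternating n G \<Longrightarrow> root_polytope e n G = convex hull (insert 0 (root e ` G))"
  by (simp add: root_polytope_def positive_roots_Int_root_cone)

lemma inner_root_root:
  assumes "x \<in> complete_graph n" "y \<in> complete_graph n"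
  shows "root e x \<bullet> root e x = 2" and "x \<noteq> y \<Longrightarrow> root e x \<bullet> root e y \<le> 1"
proof -
  obtain i j k l where xy: "x = (i, j)" "y = (k, l)"
    by (cases x, cases y) simp
  then have mem: "i \<in> {1..n}" "j \<in> {1..n}" "i < j" "k < l"
    using assms by (auto simp: mem_complete_graph)
  have "root e x \<bullet> root e z = e i \<bullet> root e z - e j \<bullet> root e z" for z
    by (simp add: xy root_def inner_diff_left)
  then show "root e x \<bullet> root e x = 2" "x \<noteq> y \<Longrightarrow> root e x \<bullet> root e y \<le> 1"
    using mem assms by (auto simp: inner_root xy)
qed

text \<open>The functional given by the root itself has value \<open>2\<close> there, but at most
  \<open>1\<close> on the other roots and \<open>0\<close> at the origin. A hyperplane separating
  \<open>0\<close> from the other vertices therefore has every positive root on its far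
  side.\<close>

lemma root_extreme_point:
  assumes x: "x \<in> complete_graph n"
  shows "root e x extreme_point_of root_polytope e n (path_graph n)"
proof -
  let ?S = "insert 0 (root e ` (complete_graph n - {x}))"
  have "convex hull ?S \<subseteq> {y. root e x \<bullet> y \<le> 1}"
    using inner_root_root(2)[OF x] by (intro hull_minimal convex_halfspace_le) auto
  then have "root e x \<notin> convex hull ?S"
    using inner_root_root(1)[OF x x] by auto
  then have "root e x extreme_point_of convex hull (insert (root e x) ?S)"
    by (intro extreme_point_of_convex_hull_insert) auto
  moreover have "insert (root e x) ?S = insert 0 (positive_roots e n)"
    using x by (auto simp: positive_roots_def)
  ultimately show ?thesis
    by (simp add: root_polytope_path)
qed

end

section \<open>Slices and the isomorphism\<close>

locale root_slice = basis_enumeration +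
  fixes a :: "'a::euclidean_space" and b :: real
  assumes b_pos: "0 < b"
    and separates: "\<And>x. x \<in> complete_graph n \<Longrightarrow> b < a \<bullet> root e x"
begin

text \<open>The point where the segment from \<open>0\<close> to the root meets the hyperplane; by
  \<open>slice_factor\<close> the scaling lies strictly between \<open>0\<close> and
  \<open>1\<close>.\<close>

definition slice_point :: "nat \<times> nat \<Rightarrow> 'a" where
  "slice_point x = (b / (a \<bullet> root e x)) *\<^sub>R root e x"

lemma slice_factor:
  assumes "x \<in> complete_graph n"
  shows "0 < b / (a \<bullet> root e x)" "b / (a \<bullet> root e x) < 1"
proof -
  have "0 < a \<bullet> root e x"
    using separates[OF assms] b_pos by linarith
  then show "0 < b / (a \<bullet> root e x)" "b / (a \<bullet> root e x) < 1"
    using separates[OF assms] b_pos by simp_all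
qed

lemma inner_slice_point: "x \<in> complete_graph n \<Longrightarrow> a \<bullet> slice_point x = b"
  using slice_factor[of x] by (auto simp: slice_point_def)

lemma slice_point_sum_unique:
  assumes G: "nc_alternating n G" "\<And>x. x \<in> G \<Longrightarrow> 0 \<le> c x"
    and G': "nc_alternating n G'" "\<And>x. x \<in> G' \<Longrightarrow> 0 \<le> d x"
    and eq: "(\<Sum>x\<in>G. c x *\<^sub>R slice_point x) = (\<Sum>x\<in>G'. d x *\<^sub>R slice_point x)"
  shows "(if x \<in> G then c x else 0) = (if x \<in> G' then d x else 0)"
proof -
  let ?r = "\<lambda>x. b / (a \<bullet> root e x)"
  have sub: "G \<subseteq> complete_graph n" "G' \<subseteq> complete_graph n"
    using G(1) G'(1) by (simp_all add: nc_alternating_def)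
  have pos: "0 < ?r x" if "x \<in> G \<or> x \<in> G'" for x
    using that sub slice_factor(1)[of x] by blast
  have "(if x \<in> G then c x * ?r x else 0) = (if x \<in> G' then d x * ?r x else 0)"
  proof (rule root_sum_unique[OF G(1) _ G'(1)])
    show "0 \<le> c x * ?r x" if "x \<in> G" for x
      using that pos[of x] G(2) by (intro mult_nonneg_nonneg) auto
    show "0 \<le> d x * ?r x" if "x \<in> G'" for x
      using that pos[of x] G'(2) by (intro mult_nonneg_nonneg) auto
    show "(\<Sum>x\<in>G. (c x * ?r x) *\<^sub>R root e x) = (\<Sum>x\<in>G'. (d x * ?r x) *\<^sub>R root e x)"
      using eq by (simp add: slice_point_def)
  qed
  then show ?thesis
    using pos[of x] by (auto split: if_splits)
qed

lemma inj_on_slice_point: "inj_on slice_point (complete_graph n)"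
proof
  fix x y assume xy: "x \<in> complete_graph n" "y \<in> complete_graph n" "slice_point x = slice_point y"
  then have "(\<Sum>z\<in>{x}. 1 *\<^sub>R slice_point z) = (\<Sum>z\<in>{y}. 1 *\<^sub>R slice_point z)"
    by simp
  from slice_point_sum_unique[OF nc_alternating_singleton _ nc_alternating_singleton _ this, of x] xy
  show "x = y"
    by (auto split: if_splits)
qed

lemma nc_alternating_inj_on: "nc_alternating n G \<Longrightarrow> inj_on slice_point G"
  using inj_on_subset[OF inj_on_slice_point] by (simp add: nc_alternating_def)

lemma nc_alternating_finite: "nc_alternating n G \<Longrightarrow> finite G"
  using finite_subset[OF _ finite_complete_graph] by (auto simp: nc_alternating_def)

text \<open>Splitting the coefficients of a linear relation into positive and negative parts gives
  two nonnegative combinations over \<open>G\<close> with the same value. By uniqueness the parts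
  agree, hence vanish.\<close>

lemma affine_independent_slice_points:
  assumes G: "nc_alternating n G"
  shows "\<not> affine_dependent (slice_point ` G)"
proof
  assume "affine_dependent (slice_point ` G)"
  then have "dependent (slice_point ` G)"
    by (rule affine_dependent_imp_dependent)
  then obtain u where u: "\<exists>y\<in>slice_point ` G. u y \<noteq> 0" "(\<Sum>y\<in>slice_point ` G. u y *\<^sub>R y) = 0"
    unfolding dependent_finite[OF finite_imageI[OF nc_alternating_finite[OF G]]] by blast
  define w where "w x = u (slice_point x)" for x
  have "(\<Sum>x\<in>G. w x *\<^sub>R slice_point x) = 0"
    using u(2) unfolding sum.reindex[OF nc_alternating_inj_on[OF G]] by (simp add: w_def)
  moreover have "w x = max (w x) 0 - max (- w x) 0" for x
    by (simp add: max_def)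
  then have "(\<Sum>x\<in>G. w x *\<^sub>R slice_point x)
      = (\<Sum>x\<in>G. max (w x) 0 *\<^sub>R slice_point x) - (\<Sum>x\<in>G. max (- w x) 0 *\<^sub>R slice_point x)"
    unfolding sum_subtractf[symmetric] scaleR_diff_left[symmetric] by simp
  ultimately have *: "(\<Sum>x\<in>G. max (w x) 0 *\<^sub>R slice_point x) = (\<Sum>x\<in>G. max (- w x) 0 *\<^sub>R slice_point x)"
    by simp
  have "w x = 0" if "x \<in> G" for x
  proof -
    have "(if x \<in> G then max (w x) 0 else 0) = (if x \<in> G then max (- w x) 0 else 0)"
      by (rule slice_point_sum_unique[OF G _ G _ *]) simp_all
    with that show ?thesis
      by (simp add: max_def split: if_splits)
  qed
  then show False
    using u(1) by (auto simp: w_def)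
qed

lemma slice_point_hullE:
  assumes G: "nc_alternating n G" and y: "y \<in> convex hull (slice_point ` G)"
  obtains c where "\<And>x. x \<in> G \<Longrightarrow> 0 \<le> c x" "sum c G = 1" "y = (\<Sum>x\<in>G. c x *\<^sub>R slice_point x)"
proof -
  obtain u where u: "\<forall>z\<in>slice_point ` G. 0 \<le> u z" "sum u (slice_point ` G) = 1"
    "(\<Sum>z\<in>slice_point ` G. u z *\<^sub>R z) = y"
    using y unfolding convex_hull_finite[OF finite_imageI[OF nc_alternating_finite[OF G]]] by blast
  show ?thesis
    using that[of "u \<circ> slice_point"] u
    unfolding sum.reindex[OF nc_alternating_inj_on[OF G]] by auto
qed

text \<open>A common point has nonnegative coefficients over both graphs; by uniqueness these vanish
  off the common edges.\<close>

lemma convex_hull_slice_points_Int: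
  assumes G: "nc_alternating n G" and G': "nc_alternating n G'"
  shows "convex hull (slice_point ` G) \<inter> convex hull (slice_point ` G')
       = convex hull (slice_point ` (G \<inter> G'))"
proof
  show "convex hull (slice_point ` G) \<inter> convex hull (slice_point ` G')
      \<subseteq> convex hull (slice_point ` (G \<inter> G'))"
  proof
    fix y assume y: "y \<in> convex hull (slice_point ` G) \<inter> convex hull (slice_point ` G')"
    obtain c where c: "\<And>x. x \<in> G \<Longrightarrow> 0 \<le> c x" "sum c G = 1" "y = (\<Sum>x\<in>G. c x *\<^sub>R slice_point x)"
      using y slice_point_hullE[OF G] by blast
    obtain d where d: "\<And>x. x \<in> G' \<Longrightarrow> 0 \<le> d x" "y = (\<Sum>x\<in>G'. d x *\<^sub>R slice_point x)"
      using y slice_point_hullE[OF G'] by blast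
    have "(if x \<in> G then c x else 0) = (if x \<in> G' then d x else 0)" for x
      by (rule slice_point_sum_unique[OF G _ G']) (use c(1,3) d in simp_all)
    then have zero: "c x = 0" if "x \<in> G" "x \<notin> G'" for x
      using that by (metis (full_types))
    have "sum c (G \<inter> G') = sum c G"
      using zero by (intro sum.mono_neutral_left nc_alternating_finite[OF G]) auto
    moreover have "(\<Sum>x\<in>G \<inter> G'. c x *\<^sub>R slice_point x) = (\<Sum>x\<in>G. c x *\<^sub>R slice_point x)"
      using zero by (intro sum.mono_neutral_left nc_alternating_finite[OF G]) auto
    moreover have "(\<Sum>x\<in>G \<inter> G'. c x *\<^sub>R slice_point x) \<in> convex hull (slice_point ` (G \<inter> G'))"
      if "sum c (G \<inter> G') = 1"
    proof (rule convex_sum[OF _ convex_convex_hull that])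
      show "finite (G \<inter> G')"
        using nc_alternating_finite[OF G] by simp
      show "0 \<le> c x" if "x \<in> G \<inter> G'" for x
        using c(1) that by simp
      show "slice_point x \<in> convex hull (slice_point ` (G \<inter> G'))" if "x \<in> G \<inter> G'" for x
        using that by (intro hull_inc imageI)
    qed
    ultimately show "y \<in> convex hull (slice_point ` (G \<inter> G'))"
      using c(2,3) by simp
  qed
qed (intro Int_greatest hull_mono image_mono Int_lower1 Int_lower2)

text \<open>The polytope lies in the cone of \<open>G\<close>, and a cone point on the hyperplane is
  a convex combination of slice points. Conversely, slice points lie on segments from
  \<open>0\<close> to the roots of \<open>G\<close>.\<close>

lemma root_polytope_slice:
  assumes G: "nc_alternating n G"
  shows "root_polytope e n G \<inter> {y. a \<bullet> y = b} = convex hull (slice_point ` G)"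
proof
  have sub: "G \<subseteq> complete_graph n" and fin: "finite G"
    using G nc_alternating_finite by (auto simp: nc_alternating_def)
  have cone: "convex (root_cone e G)"
  proof (rule convexI)
    fix y z :: 'a and u v :: real
    assume yz: "y \<in> root_cone e G" "z \<in> root_cone e G" and uv: "0 \<le> u" "0 \<le> v" "u + v = 1"
    obtain c where c: "y = (\<Sum>x\<in>G. c x *\<^sub>R root e x)" "\<forall>x\<in>G. 0 \<le> c x"
      using yz(1) by (auto simp: root_cone_def)
    obtain d where d: "z = (\<Sum>x\<in>G. d x *\<^sub>R root e x)" "\<forall>x\<in>G. 0 \<le> d x"
      using yz(2) by (auto simp: root_cone_def)
    have "u *\<^sub>R y + v *\<^sub>R z = (\<Sum>x\<in>G. (u * c x + v * d x) *\<^sub>R root e x)"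
      by (simp add: c(1) d(1) scaleR_sum_right scaleR_add_left sum.distrib)
    then show "u *\<^sub>R y + v *\<^sub>R z \<in> root_cone e G"
      unfolding root_cone_def using c(2) d(2) uv
      by (intro CollectI exI[of _ "\<lambda>x. u * c x + v * d x"]) auto
  qed
  have "0 \<in> root_cone e G"
    unfolding root_cone_def by (intro CollectI exI[of _ "\<lambda>_. 0"]) auto
  moreover have "root e ` G \<subseteq> root_cone e G"
    using positive_roots_Int_root_cone[OF G] by blast
  ultimately have hull: "root_polytope e n G \<subseteq> root_cone e G"
    unfolding root_polytope_nc_alternating[OF G] using cone by (intro hull_minimal) auto
  show "root_polytope e n G \<inter> {y. a \<bullet> y = b} \<subseteq> convex hull (slice_point ` G)"
  proof
    fix y assume y: "y \<in> root_polytope e n G \<inter> {y. a \<bullet> y = b}"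
    then have "y \<in> root_cone e G"
      using hull by blast
    then obtain c where c: "y = (\<Sum>x\<in>G. c x *\<^sub>R root e x)" "\<forall>x\<in>G. 0 \<le> c x"
      by (auto simp: root_cone_def)
    have pos: "0 < a \<bullet> root e x" if "x \<in> G" for x
      using separates[of x] b_pos that sub by fastforce
    \<comment> \<open>The factor undoes the scaling in \<open>slice_point\<close>; the weights sum
      to \<open>(a \<bullet> y) / b = 1\<close>.\<close>
    let ?w = "\<lambda>x. c x * (a \<bullet> root e x) / b"
    have "(\<Sum>x\<in>G. ?w x) = (a \<bullet> y) / b"
      by (simp add: c(1) inner_sum_right sum_divide_distrib)
    then have "sum ?w G = 1"
      using y b_pos by simp
    then have "(\<Sum>x\<in>G. ?w x *\<^sub>R slice_point x) \<in> convex hull (slice_point ` G)"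
    proof (rule convex_sum[OF fin convex_convex_hull])
      show "0 \<le> ?w x" if "x \<in> G" for x
        using c(2) pos[OF that] b_pos that by simp
      show "slice_point x \<in> convex hull (slice_point ` G)" if "x \<in> G" for x
        using that by (intro hull_inc imageI)
    qed
    moreover have "(\<Sum>x\<in>G. ?w x *\<^sub>R slice_point x) = y"
      unfolding c(1) using pos b_pos by (intro sum.cong) (auto simp: slice_point_def dest!: pos)
    ultimately show "y \<in> convex hull (slice_point ` G)"
      by simp
  qed
  have "slice_point x \<in> root_polytope e n G \<inter> {y. a \<bullet> y = b}" if "x \<in> G" for x
  proof -
    let ?r = "b / (a \<bullet> root e x)"
    have x: "x \<in> complete_graph n"
      using that sub by blast
    have "?r *\<^sub>R root e x + (1 - ?r) *\<^sub>R 0 \<in> convex hull (insert 0 (root e ` G))"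
      using that slice_factor[OF x]
      by (intro convexD[OF convex_convex_hull] hull_inc) auto
    then show ?thesis
      using inner_slice_point[OF x] by (simp add: root_polytope_nc_alternating[OF G] slice_point_def)
  qed
  moreover have "convex (root_polytope e n G \<inter> {y. a \<bullet> y = b})"
    by (simp add: root_polytope_def convex_Int convex_hyperplane)
  ultimately show "convex hull (slice_point ` G) \<subseteq> root_polytope e n G \<inter> {y. a \<bullet> y = b}"
    by (intro hull_minimal) auto
qed

lemma canonical_triangulation_eq:
  assumes "2 \<le> n"
  shows "canonical_triangulation e n {y. a \<bullet> y = b}
       = {convex hull (slice_point ` G) | G. nc_alternating n G}"
proof -
  have slice: "root_polytope e n G \<inter> vertex_figure e n {y. a \<bullet> y = b} = convex hull (slice_point ` G)"
    if G: "nc_alternating n G" for G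
  proof -
    have "root_polytope e n G \<subseteq> root_polytope e n (path_graph n)"
      unfolding root_polytope_path unfolding root_polytope_def by (intro hull_mono) auto
    then have "root_polytope e n G \<inter> vertex_figure e n {y. a \<bullet> y = b}
        = root_polytope e n G \<inter> {y. a \<bullet> y = b}"
      unfolding vertex_figure_def by blast
    then show ?thesis
      using root_polytope_slice[OF G] by simp
  qed
  have "canonical_triangulation e n {y. a \<bullet> y = b}
      = {root_polytope e n G \<inter> vertex_figure e n {y. a \<bullet> y = b} | G. nc_alternating n G}"
    unfolding canonical_triangulation_def nc_alternating_iff_tree_subgraph[OF assms] by blast
  then show ?thesis
    unfolding setcompr_eq_image using slice by simp
qed

lemma simplicial_complex_slice:
  "simplicial_complex {convex hull (slice_point ` G) | G. nc_alternating n G}" (is "simplicial_complex ?K")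
  unfolding simplicial_complex_def
proof (intro conjI ballI allI impI)
  have "?K = (\<lambda>G. convex hull (slice_point ` G)) ` {G. nc_alternating n G}"
    by blast
  moreover have "finite {G. nc_alternating n G}"
    by (rule finite_subset[of _ "Pow (complete_graph n)"]) (auto simp: nc_alternating_def)
  ultimately show "finite ?K"
    by simp
next
  fix S assume "S \<in> ?K"
  then obtain G where G: "nc_alternating n G" "S = convex hull (slice_point ` G)" by blast
  \<comment> \<open>The empty graph gives the empty simplex, of dimension \<open>-1\<close>.\<close>
  then show "\<exists>d. d simplex S"
    unfolding simplex_def using affine_independent_slice_points[OF G(1)]
    by (intro exI[of _ "int (card (slice_point ` G)) - 1"] exI[of _ "slice_point ` G"]) simp
next
  fix F S assume "S \<in> ?K \<and> F face_of S"
  then obtain G where G: "nc_alternating n G" "F face_of convex hull (slice_point ` G)" by blast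
  \<comment> \<open>Faces of the simplex are hulls of vertex subsets, which come from subgraphs of
    \<open>G\<close>.\<close>
  then obtain C where "C \<subseteq> slice_point ` G" "F = convex hull C"
    unfolding face_of_convex_hull_affine_independent[OF affine_independent_slice_points[OF G(1)]]
    by blast
  then obtain G' where "G' \<subseteq> G" "F = convex hull (slice_point ` G')"
    unfolding subset_image_iff by blast
  then show "F \<in> ?K"
    using nc_alternating_subset[OF G(1)] by blast
next
  fix S S' assume "S \<in> ?K \<and> S' \<in> ?K"
  then obtain G G' where G: "nc_alternating n G" "S = convex hull (slice_point ` G)"
    and G': "nc_alternating n G'" "S' = convex hull (slice_point ` G')"
    by blast
  have "S \<inter> S' = convex hull (slice_point ` (G \<inter> G'))"
    using convex_hull_slice_points_Int[OF G(1) G'(1)] G(2) G'(2) by simp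
  moreover have "convex hull (slice_point ` (G \<inter> G')) face_of convex hull (slice_point ` G)"
    unfolding face_of_convex_hull_affine_independent[OF affine_independent_slice_points[OF G(1)]]
    by (intro exI[of _ "slice_point ` (G \<inter> G')"]) auto
  ultimately show "(S \<inter> S') face_of S"
    using G(2) by (simp only:)
qed

lemma vertex_sets_slice:
  "vertex_sets {convex hull (slice_point ` G) | G. nc_alternating n G}
     = (\<lambda>G. slice_point ` G) ` {G. nc_alternating n G}"
proof -
  have "{v. v extreme_point_of convex hull (slice_point ` G)} = slice_point ` G"
    if "nc_alternating n G" for G
    using extreme_point_of_convex_hull_affine_independent[OF affine_independent_slice_points[OF that]]
    by blast
  then show ?thesis
    unfolding vertex_sets_def by (auto simp: image_iff)
qed

end

section \<open>Boxes as edges\<close>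

definition box_edge :: "nat \<Rightarrow> nat \<times> nat \<Rightarrow> nat \<times> nat" where
  "box_edge n = (\<lambda>(i, j). (i, n + 1 - j))"

lemma bij_betw_box_edge: "bij_betw (box_edge n) (boxes n) (complete_graph n)"
\<comment> \<open>On boxes and on edges the formula is its own inverse.\<close>
proof (rule bij_betw_byWitness[of _ "box_edge n"])
  show "box_edge n ` boxes n \<subseteq> complete_graph n" "box_edge n ` complete_graph n \<subseteq> boxes n"
    by (auto simp: box_edge_def boxes_def complete_graph_def)
qed (auto simp: box_edge_def boxes_def complete_graph_def)

text \<open>Reflecting the columns turns \<open>b < a\<close> into the order of the right endpoints,
  and \<open>j + a \<le> n + 1\<close> into \<open>j \<le> k\<close> for the right end
  \<open>k = n + 1 - a\<close> of the first edge: equality gives a path, strict inequality a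
  crossing.\<close>

lemma nc_alternating_box_edge:
  assumes F: "F \<subseteq> boxes n"
  shows "nc_alternating n (box_edge n ` F) \<longleftrightarrow> \<not> box_conflict n F"
proof
  assume G: "nc_alternating n (box_edge n ` F)"
  show "\<not> box_conflict n F"
  proof
    assume "box_conflict n F"
    then obtain i a j b where *: "(i, a) \<in> F" "(j, b) \<in> F" "i < j" "b < a" "j + a \<le> n + 1"
      by (rule box_conflictE)
    have edges: "(i, n + 1 - a) \<in> box_edge n ` F" "(j, n + 1 - b) \<in> box_edge n ` F"
      using *(1,2) by (force simp: box_edge_def)+
    consider "j = n + 1 - a" | "j < n + 1 - a" "n + 1 - a < n + 1 - b"
      using *(3-5) by linarith
    then show False
    proof cases
      case 1
      then show ?thesis
        using nc_alternating_path[OF G edges(1)] edges(2) by metis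
    next
      case 2
      then show ?thesis
        using nc_alternating_crossing[OF G edges *(3)] by simp
    qed
  qed
next
  assume F': "\<not> box_conflict n F"
  have none: False if *: "(i, k) \<in> box_edge n ` F" "(j, l) \<in> box_edge n ` F" "i < j" "j \<le> k" "k < l" for i j k l
  proof -
    obtain a b where ab: "(i, a) \<in> F" "k = n + 1 - a" "(j, b) \<in> F" "l = n + 1 - b"
      using *(1,2) by (auto simp: box_edge_def)
    \<comment> \<open>These bounds keep the truncated subtractions \<open>n + 1 - a\<close> and
      \<open>n + 1 - b\<close> exact.\<close>
    moreover have "i + a \<le> n" "j + b \<le> n"
      using ab F by (auto simp: boxes_def)
    then have "b < a" "j + a \<le> n + 1"
      using *(4,5) ab by simp_all
    ultimately show False
      using F' *(3) unfolding box_conflict_def by blast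
  qed
  have edge: "1 \<le> i \<and> i < j \<and> j \<le> n" if "(i, j) \<in> box_edge n ` F" for i j
  proof -
    have "(i, j) \<in> complete_graph n"
      using that bij_betw_imp_surj_on[OF bij_betw_box_edge[of n]] F by blast
    then show ?thesis
      by (simp add: mem_complete_graph)
  qed
  show "nc_alternating n (box_edge n ` F)"
  proof (rule nc_alternatingI)
    fix i j k
    assume *: "(i, j) \<in> box_edge n ` F" "(j, k) \<in> box_edge n ` F"
    show False
      using none[OF *] edge[OF *(1)] edge[OF *(2)] by simp
  next
    fix i j k l
    assume *: "(i, k) \<in> box_edge n ` F" "(j, l) \<in> box_edge n ` F" and "i < j" "j < k" "k < l"
    then show False
      using none[OF *] by simp
  qed (rule edge)
qed

theorem theorem5p3:
  fixes n :: nat and e :: "nat \<Rightarrow> real ^ 'n" and H :: "(real ^ 'n) set"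
  assumes "n \<ge> 2"
    and "bij_betw e {1..n} Basis"
    and "separates_zero H (root_polytope e n (path_graph n))"
  shows "geometric_realization (canonical_triangulation e n H)
           (boxes n) (pipe_dream_complex n (pi_perm n))"
proof -
  obtain a b where H: "H = {y. a \<bullet> y = b}" and b: "0 < b"
    and sep: "\<And>v. v extreme_point_of root_polytope e n (path_graph n) \<Longrightarrow> v \<noteq> 0 \<Longrightarrow> b < a \<bullet> v"
    using assms(3) unfolding separates_zero_def by auto
  interpret basis_enumeration e n
    by unfold_locales (rule assms(2))
  interpret root_slice e n a b
  proof
    show "b < a \<bullet> root e x" if "x \<in> complete_graph n" for x
    proof (rule sep[OF root_extreme_point[OF that]])
      show "root e x \<noteq> 0"
        using inner_root_root(1)[OF that that] by auto
    qed
  qed (rule b)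
  let ?K = "{convex hull (slice_point ` G) | G. nc_alternating n G}"
  let ?f = "slice_point \<circ> box_edge n"
  have K: "canonical_triangulation e n H = ?K"
    unfolding H by (rule canonical_triangulation_eq[OF assms(1)])
  have graphs: "{G. nc_alternating n G} = (\<lambda>F. box_edge n ` F) ` {F. F \<subseteq> boxes n \<and> \<not> box_conflict n F}"
  proof (intro equalityI subsetI)
    fix G assume "G \<in> {G. nc_alternating n G}"
    then have G: "nc_alternating n G" "G \<subseteq> box_edge n ` boxes n"
      using bij_betw_box_edge[of n] by (auto simp: bij_betw_def nc_alternating_def)
    then obtain F where "F \<subseteq> boxes n" "G = box_edge n ` F"
      unfolding subset_image_iff by blast
    with G(1) show "G \<in> (\<lambda>F. box_edge n ` F) ` {F. F \<subseteq> boxes n \<and> \<not> box_conflict n F}"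
      using nc_alternating_box_edge by blast
  qed (use nc_alternating_box_edge in blast)
  have faces: "(\<lambda>F. ?f ` F) ` pipe_dream_complex n (pi_perm n) = vertex_sets ?K"
    using assms(1) by (simp add: pipe_dream_complex_pi_perm vertex_sets_slice graphs image_image image_comp)
  have "\<Union> (vertex_sets ?K) = slice_point ` \<Union> {G. nc_alternating n G}"
    unfolding vertex_sets_slice by blast
  \<comment> \<open>Single edges are noncrossing and alternating, so every slice point, and with it
    every box, gives a vertex.\<close>
  also have "\<Union> {G. nc_alternating n G} = complete_graph n"
  proof
    show "complete_graph n \<subseteq> \<Union> {G. nc_alternating n G}"
      using nc_alternating_singleton by blast
  qed (auto simp: nc_alternating_def)
  finally have "bij_betw slice_point (complete_graph n) (\<Union> (vertex_sets ?K))"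
    using inj_on_slice_point by (simp add: bij_betw_def)
  then have "bij_betw ?f (boxes n) (\<Union> (vertex_sets ?K))"
    by (rule bij_betw_trans[OF bij_betw_box_edge])
  then show ?thesis
    unfolding geometric_realization_def isomorphic_complexes_def K
    using simplicial_complex_slice faces by blast
qed

end
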